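(* There exists an absolute constant $C$ so that the following holds. Let $H,G$ be bipartite graphs with $G\to(H)_q$. Suppose $\Delta(H)\le k$, $\Delta(G)\le\Delta$, and let $H'$ be some $w$-blowup of $H$. Then, for $s:=(\Delta q)^{Ck\Delta^2w}$, there is an $s$-blowup $G'$ of $G$ so that $G'\to_{\mathrm{ind}}(H')_q$. Consequently, $$r_{\mathrm{ind}}(H';q)\le s|V(G)|,$$ and $$\hat r_{\mathrm{ind}}(H';q)\le s^2e(G)\le s^2\Delta|V(G)|.$$
   Context: For a graph $G$, $\Delta(G)$ is the maximum degree and $e(G)$ the number of edges. Write $G\to(H)_q$ if for every coloring of $E(G)$ with $q$ colors there is a monochromatic (not necessarily induced) copy of $H$ in $G$. Write $G\to_{\mathrm{ind}}(H)_q$ if for every coloring of $E(G)$ with $q$ colors there is some monochromatic copy of $H$ which is an induced subgraph of $G$. Define $r_{\mathrm{ind}}(H;q)$ (respectively $\hat r_{\mathrm{ind}}(H;q)$) to be the minimum number of vertices (respectively edges) that a graph $G$ with $G\to_{\mathrm{ind}}(H)_q$ can have. A graph $G'$ is an $s$-blowup of a graph $G$ if there is a homomorphism $\phi:V(G')\to V(G)$, so that $uv\in E(G')$ implies $\phi(u)\phi(v)\in E(G)$, and furthermore $|\phi^{-1}(v)|\le s$ for each vertex $v\in V(G)$. (In particular there are no edges inside the sets $\phi^{-1}(v)$.)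
   Formalization: The degenerate cases k = 0 and Δq ≤ 1 are excluded; there s is at most 1 and the claim fails, e.g. k = 0, H = G a single vertex, H' two isolated vertices (w = 2), or Δ = q = 1, H = G = K_2, H' = K_{2,2}. *)

theory Defs
  imports Main "HOL-Library.FuncSet" "HOL-Library.Extended_Nat"
begin

datatype 'a graph = Graph (verts: "'a set") (edges: "'a set set")

definition simple_graph :: "'a graph \<Rightarrow> bool" where
  "simple_graph G \<longleftrightarrow> finite (verts G) \<and>
     edges G \<subseteq> {{u, v} | u v. u \<in> verts G \<and> v \<in> verts G \<and> u \<noteq> v}"

definition degree :: "'a graph \<Rightarrow> 'a \<Rightarrow> nat" where
  "degree G v = card {e \<in> edges G. v \<in> e}"

(* The inserted 0 only matters for the graph without vertices, whose maximum degree is 0. *)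
definition max_degree :: "'a graph \<Rightarrow> nat" where
  "max_degree G = Max (insert 0 (degree G ` verts G))"

definition bipartite :: "'a graph \<Rightarrow> bool" where
  "bipartite G \<longleftrightarrow> (\<exists>A B. A \<union> B = verts G \<and> A \<inter> B = {} \<and>
     (\<forall>e \<in> edges G. \<exists>a \<in> A. \<exists>b \<in> B. e = {a, b}))"

definition subgraph :: "'a graph \<Rightarrow> 'a graph \<Rightarrow> bool" where
  "subgraph K G \<longleftrightarrow> simple_graph K \<and> verts K \<subseteq> verts G \<and> edges K \<subseteq> edges G"

definition induced_subgraph :: "'a graph \<Rightarrow> 'a graph \<Rightarrow> bool" where
  "induced_subgraph K G \<longleftrightarrow>
     verts K \<subseteq> verts G \<and> edges K = {e \<in> edges G. e \<subseteq> verts K}"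

definition isomorphic :: "'a graph \<Rightarrow> 'b graph \<Rightarrow> bool" where
  "isomorphic H K \<longleftrightarrow>
     (\<exists>f. bij_betw f (verts H) (verts K) \<and> edges K = (\<lambda>e. f ` e) ` edges H)"

definition monochromatic :: "('a set \<Rightarrow> nat) \<Rightarrow> 'a graph \<Rightarrow> bool" where
  "monochromatic c K \<longleftrightarrow> (\<exists>i. \<forall>e \<in> edges K. c e = i)"

(* A copy of H in G is a subgraph of G isomorphic to H; the q colours are 0, ..., q - 1. *)
definition arrows :: "'a graph \<Rightarrow> 'b graph \<Rightarrow> nat \<Rightarrow> bool" where
  "arrows G H q \<longleftrightarrow> (\<forall>c \<in> edges G \<rightarrow> {..<q}.
     \<exists>K. subgraph K G \<and> isomorphic H K \<and> monochromatic c K)"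

definition arrows_ind :: "'a graph \<Rightarrow> 'b graph \<Rightarrow> nat \<Rightarrow> bool" where
  "arrows_ind G H q \<longleftrightarrow> (\<forall>c \<in> edges G \<rightarrow> {..<q}.
     \<exists>K. induced_subgraph K G \<and> isomorphic H K \<and> monochromatic c K)"

(* Every finite graph is isomorphic to one with vertices in nat, so it suffices to minimise
   over those. The values are in enat, where the infimum of the empty set is infinity:
   a finite upper bound thus includes the existence of a suitable graph. *)
definition r_ind :: "'a graph \<Rightarrow> nat \<Rightarrow> enat" where
  "r_ind H q =
     Inf {enat (card (verts G)) | G :: nat graph. simple_graph G \<and> arrows_ind G H q}"

definition size_r_ind :: "'a graph \<Rightarrow> nat \<Rightarrow> enat" where
  "size_r_ind H q =
     Inf {enat (card (edges G)) | G :: nat graph. simple_graph G \<and> arrows_ind G H q}"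

definition blowup :: "nat \<Rightarrow> 'b graph \<Rightarrow> 'a graph \<Rightarrow> bool" where
  "blowup s G' G \<longleftrightarrow> simple_graph G' \<and>
     (\<exists>\<phi> \<in> verts G' \<rightarrow> verts G.
        (\<forall>u v. {u, v} \<in> edges G' \<longrightarrow> {\<phi> u, \<phi> v} \<in> edges G) \<and>
        (\<forall>v \<in> verts G. card {u \<in> verts G'. \<phi> u = v} \<le> s))"

end

theory Submission
  imports Defs Complex_Main "HOL-Library.Nat_Bijection"
begin

text \<open>
  Split \<open>G\<close> into its sides \<open>X\<close> and \<open>Y\<close>, replace every vertex by \<open>N\<close> copies and every edge \<open>{x, y}\<close> by one
  and the same bipartite graph on \<open>N + N\<close> vertices, read off from the signs of a Hadamard matrix
  (\<open>ex_balanced_bipartite_graph\<close>). For any set \<open>A\<close> on one side of it, all but \<open>4 * N / card A\<close>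
  vertices on the other side have at least a quarter of \<open>A\<close> as neighbours, and likewise for
  non-neighbours.

  Let the edges of this blowup be coloured. Dependent random choice, applied to one \<open>y\<close> in \<open>Y\<close> after the
  other, yields large sets \<open>A x\<close> of copies of each \<open>x\<close> in \<open>X\<close> and a colour \<open>c y x\<close> for each edge \<open>{x, y}\<close>,
  such that any \<open>k * w\<close> vertices in the sets \<open>A x\<close> around \<open>y\<close> have at least \<open>m\<close> common neighbours among the
  copies of \<open>y\<close>, all joined to them in the colours \<open>c\<close> (\<open>uniform_colours\<close>). Colouring \<open>{x, y}\<close> by
  \<open>c y x\<close>, the hypothesis on \<open>G\<close> gives a monochromatic copy of \<open>H\<close> in \<open>G\<close>, of colour \<open>i\<close> say. Its edges, and
  also the other edges of \<open>G\<close>, stand for pairs of classes between which \<open>H'\<close> has to be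
  embedded as an induced subgraph.

  Vertices of \<open>H'\<close> above \<open>X\<close> are placed into the sets \<open>A x\<close>. A vertex \<open>v\<close> of \<open>H'\<close> above \<open>y\<close> has at most \<open>k * w\<close>
  neighbours, whose images have many common neighbours in colour \<open>i\<close> whatever the choice. It must moreover avoid
  adjacency to the images of the at most \<open>\<Delta> * w\<close> other vertices around \<open>y\<close>. For random images each
  of these prohibitions typically keeps a quarter of the candidates, and the exceptional probability is tiny. There
  is one such event for each \<open>y\<close>, and the number of these is not bounded in terms of the
  parameters, but each image influences at most \<open>\<Delta>\<close> of them. A greedy choice therefore avoids them all
  (\<open>avoid_bad_events\<close>, \<open>choose_spread_vertices\<close>), and then the vertices above \<open>Y\<close> can be placed
  one class at a time (\<open>bipartite_blowup_arrows_ind\<close>).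

  Quantitatively, each \<open>A x\<close> is refined at most \<open>\<Delta>\<close> times, and each time it keeps a fraction of about
  \<open>(4 * q) ^ (- 2 * k * \<Delta> * w)\<close>. This is why \<open>N\<close>, a power of \<open>\<Delta> * q\<close>, needs an exponent of order
  \<open>k * \<Delta>\<^sup>2 * w\<close>.
\<close>

section \<open>Balanced bipartite graphs from Hadamard matrices\<close>

text \<open>
  Sylvester's doubling of a Hadamard matrix: four copies of the matrix of order \<open>N\<close> in a square, the
  last one negated, are again symmetric with orthogonal rows. Two rows that agree modulo \<open>N\<close> are
  orthogonal because the contributions of the two halves cancel.
\<close>

lemma ex_sylvester_matrix:
  "\<exists>h :: nat \<Rightarrow> nat \<Rightarrow> int. (\<forall>i j. h i j = 1 \<or> h i j = - 1) \<and> (\<forall>i j. h i j = h j i) \<and>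
     (\<forall>i < 2 ^ n. \<forall>j < 2 ^ n. i \<noteq> j \<longrightarrow> (\<Sum>r < 2 ^ n. h i r * h j r) = 0)"
proof (induction n)
  case 0
  show ?case by (intro exI[of _ "\<lambda>_ _. 1"]) auto
next
  case (Suc n)
  then obtain h :: "nat \<Rightarrow> nat \<Rightarrow> int" where h: "\<And>i j. h i j = 1 \<or> h i j = - 1"
    "\<And>i j. h i j = h j i"
    "\<And>i j. i < 2 ^ n \<Longrightarrow> j < 2 ^ n \<Longrightarrow> i \<noteq> j \<Longrightarrow> (\<Sum>r < 2 ^ n. h i r * h j r) = 0"
    by blast
  define N :: nat where "N = 2 ^ n"
  have N: "N > 0" by (simp add: N_def)
  define s :: "nat \<Rightarrow> nat \<Rightarrow> int" where "s i j = (if N \<le> i \<and> N \<le> j then - 1 else 1)" for i j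
  define g where "g i j = h (i mod N) (j mod N) * s i j" for i j
  have split: "(\<Sum>r < 2 * N. f r) = (\<Sum>r < N. f r + f (N + r))" for f :: "nat \<Rightarrow> int"
    using sum.nat_group[of f N 2]
    by (simp add: sum.distrib sum.lessThan_Suc mult_2 lessThan_atLeast0 add.commute
        sum.atLeastLessThan_concat[symmetric, of 0 N "N+N"]
        sum.shift_bounds_nat_ivl[of f 0 N N, simplified])
  have "(\<Sum>r < 2 * N. g i r * g j r) = 0" if ij: "i < 2 * N" "j < 2 * N" "i \<noteq> j" for i j
  proof -
    have "(\<Sum>r < 2 * N. g i r * g j r) =
        (\<Sum>r < N. h (i mod N) r * h (j mod N) r * (1 + s i N * s j N))"
      unfolding split by (rule sum.cong) (auto simp: g_def s_def algebra_simps)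
    also have "\<dots> = (1 + s i N * s j N) * (\<Sum>r < N. h (i mod N) r * h (j mod N) r)"
      by (simp add: sum_distrib_left mult.commute)
    also have "\<dots> = 0"
    proof (cases "i mod N = j mod N")
      case True
      have "(i < N) \<noteq> (j < N)"
      proof
        assume "(i < N) = (j < N)"
        then show False using True ij by (auto simp: le_mod_geq not_less)
      qed
      then show ?thesis by (auto simp: s_def)
    next
      case False
      then show ?thesis using h(3)[of "i mod N" "j mod N"] N by (simp add: N_def)
    qed
    finally show ?thesis .
  qed
  moreover have "g i j = 1 \<or> g i j = - 1" for i j
    using h(1)[of "i mod N" "j mod N"] by (auto simp: g_def s_def)
  moreover have "g i j = g j i" for i j
    using h(2)[of "i mod N" "j mod N"] by (auto simp: g_def s_def)
  ultimately show ?case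
    by (intro exI[of _ g]) (simp add: N_def)
qed

text \<open>
  Second moment: by orthogonality the squares of the column sums over the rows in \<open>A\<close> add up to
  \<open>N * card A\<close>, whereas a column in which one sign takes up less than a quarter of \<open>A\<close> alone
  contributes at least \<open>(card A)\<^sup>2 / 4\<close>.
\<close>

lemma few_unbalanced_columns:
  fixes h :: "nat \<Rightarrow> nat \<Rightarrow> int"
  assumes sign: "\<And>i j. h i j = 1 \<or> h i j = - 1"
    and orth: "\<And>i j. i < N \<Longrightarrow> j < N \<Longrightarrow> i \<noteq> j \<Longrightarrow> (\<Sum>r < N. h i r * h j r) = 0"
    and A: "A \<subseteq> {..<N}"
    and eps: "\<epsilon> = 1 \<or> \<epsilon> = - 1"
  shows "card {r \<in> {..<N}. 4 * card {u \<in> A. h u r = \<epsilon>} < card A} * card A \<le> 4 * N"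
proof (cases "A = {}")
  case True
  then show ?thesis by simp
next
  case False
  have fin: "finite A" using A finite_subset by blast
  have cA: "card A > 0" using fin False by (simp add: card_gt_0_iff)
  define R where "R = {r \<in> {..<N}. 4 * card {u \<in> A. h u r = \<epsilon>} < card A}"
  have big: "int (card A) ^ 2 \<le> 4 * (\<Sum>u \<in> A. h u r) ^ 2" if "r \<in> R" for r
  proof -
    have "\<epsilon> * (\<Sum>u \<in> A. h u r) = (\<Sum>u \<in> A. 2 * (if h u r = \<epsilon> then 1 else 0) - 1)"
      unfolding sum_distrib_left by (rule sum.cong) (use sign eps in \<open>auto; fastforce\<close>)+
    also have "\<dots> = 2 * (\<Sum>u \<in> A. if h u r = \<epsilon> then 1 else 0) - int (card A)"
      by (simp only: sum_subtractf sum_distrib_left[symmetric]) simp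
    also have "(\<Sum>u \<in> A. if h u r = \<epsilon> then 1 else 0) = int (card {u \<in> A. h u r = \<epsilon>})"
      using fin by (simp add: sum.If_cases Int_def)
    finally have "int (card A) \<le> - 2 * (\<epsilon> * (\<Sum>u \<in> A. h u r))"
      using that by (simp add: R_def)
    then have "int (card A) ^ 2 \<le> (- 2 * (\<epsilon> * (\<Sum>u \<in> A. h u r))) ^ 2"
      by (intro power_mono) auto
    then show ?thesis using eps by (auto simp: power_mult_distrib)
  qed
  have "(\<Sum>r < N. (\<Sum>u \<in> A. h u r) ^ 2) = (\<Sum>u \<in> A. \<Sum>v \<in> A. \<Sum>r < N. h u r * h v r)"
  proof -
    have "(\<Sum>r < N. (\<Sum>u \<in> A. h u r) ^ 2) = (\<Sum>r < N. \<Sum>u \<in> A. \<Sum>v \<in> A. h u r * h v r)"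
      by (simp add: power2_eq_square sum_product)
    also have "\<dots> = (\<Sum>u \<in> A. \<Sum>r < N. \<Sum>v \<in> A. h u r * h v r)" by (rule sum.swap)
    also have "\<dots> = (\<Sum>u \<in> A. \<Sum>v \<in> A. \<Sum>r < N. h u r * h v r)"
      by (rule sum.cong[OF refl]) (rule sum.swap)
    finally show ?thesis .
  qed
  also have "\<dots> = (\<Sum>u \<in> A. \<Sum>v \<in> A. if u = v then int N else 0)"
  proof (intro sum.cong refl)
    fix u v assume uv: "u \<in> A" "v \<in> A"
    have "h u r * h u r = 1" for r using sign[of u r] by auto
    then show "(\<Sum>r < N. h u r * h v r) = (if u = v then int N else 0)"
      using orth[of u v] uv A by auto
  qed
  also have "\<dots> = int N * int (card A)" using fin by simp
  finally have second_moment: "(\<Sum>r < N. (\<Sum>u \<in> A. h u r) ^ 2) = int N * int (card A)" .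
  have "int (card R) * int (card A) ^ 2 = (\<Sum>r \<in> R. int (card A) ^ 2)" by simp
  also have "\<dots> \<le> (\<Sum>r \<in> R. 4 * (\<Sum>u \<in> A. h u r) ^ 2)" by (intro sum_mono big)
  also have "\<dots> \<le> (\<Sum>r < N. 4 * (\<Sum>u \<in> A. h u r) ^ 2)"
    by (intro sum_mono2) (auto simp: R_def)
  also have "\<dots> = 4 * (int N * int (card A))"
    by (simp only: sum_distrib_left[symmetric] second_moment)
  finally have "int (card A) * (int (card R) * int (card A)) \<le> int (card A) * (4 * int N)"
    by (simp add: power2_eq_square algebra_simps)
  then have "int (card R) * int (card A) \<le> 4 * int N"
    using cA by (simp only: mult_le_cancel_left)
  then have "card R * card A \<le> 4 * N" by (metis of_nat_le_iff of_nat_mult of_nat_numeral)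
  then show ?thesis by (simp add: R_def)
qed

text \<open>
  This is all the quasirandomness that the blowup needs. Adjacency is a negative entry of Sylvester's matrix;
  as the matrix is symmetric, columns and rows are equally balanced, in either sign.
\<close>

lemma ex_balanced_bipartite_graph:
  "\<exists>adj :: nat \<Rightarrow> nat \<Rightarrow> bool.
     (\<forall>A \<subseteq> {..<2 ^ n}. card {r \<in> {..<2 ^ n}. 4 * card {u \<in> A. adj u r} < card A} * card A \<le> 4 * 2 ^ n) \<and>
     (\<forall>Z \<subseteq> {..<2 ^ n}. card {u \<in> {..<2 ^ n}. 4 * card {r \<in> Z. \<not> adj u r} < card Z} * card Z \<le> 4 * 2 ^ n)"
proof -
  obtain h :: "nat \<Rightarrow> nat \<Rightarrow> int" where h: "\<And>i j. h i j = 1 \<or> h i j = - 1" "\<And>i j. h i j = h j i"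
    "\<And>i j. i < 2 ^ n \<Longrightarrow> j < 2 ^ n \<Longrightarrow> i \<noteq> j \<Longrightarrow> (\<Sum>r < 2 ^ n. h i r * h j r) = 0"
    using ex_sylvester_matrix[of n] by blast
  have nonadj: "\<not> h u r = - 1 \<longleftrightarrow> h r u = 1" for u r using h(1)[of u r] h(2)[of u r] by auto
  have "card {r \<in> {..<2 ^ n}. 4 * card {u \<in> A. h u r = - 1} < card A} * card A \<le> 4 * 2 ^ n"
    if "A \<subseteq> {..<2 ^ n}" for A
    by (rule few_unbalanced_columns[OF h(1,3) that]) auto
  moreover have "card {u \<in> {..<2 ^ n}. 4 * card {r \<in> Z. \<not> h u r = - 1} < card Z} * card Z \<le> 4 * 2 ^ n"
    if "Z \<subseteq> {..<2 ^ n}" for Z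
    unfolding nonadj by (rule few_unbalanced_columns[OF h(1,3) that]) auto
  ultimately show ?thesis by (intro exI[of _ "\<lambda>u r. h u r = - 1"]) blast
qed

section \<open>Counting\<close>

lemma double_count:
  assumes "finite X" "finite Y"
  shows "(\<Sum>x \<in> X. card {y \<in> Y. Q x y}) = (\<Sum>y \<in> Y. card {x \<in> X. Q x y})"
proof -
  have "(\<Sum>x \<in> X. card {y \<in> Y. Q x y}) = (\<Sum>x \<in> X. \<Sum>y \<in> Y. if Q x y then 1 else 0)"
    using assms by (simp add: sum.If_cases Int_def)
  also have "\<dots> = (\<Sum>y \<in> Y. \<Sum>x \<in> X. if Q x y then 1 else 0)" by (rule sum.swap)
  also have "\<dots> = (\<Sum>y \<in> Y. card {x \<in> X. Q x y})"
    using assms by (simp add: sum.If_cases Int_def)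
  finally show ?thesis .
qed

text \<open>
  Bernoulli's inequality, applied to the ratio of each term to the average.
\<close>

lemma power_mean:
  fixes f :: "'a \<Rightarrow> nat"
  assumes "finite X"
  shows "card X * (\<Sum>x \<in> X. f x) ^ t \<le> card X ^ t * (\<Sum>x \<in> X. f x ^ t)"
proof (cases "(\<Sum>x \<in> X. f x) = 0")
  case True
  then show ?thesis using assms by (cases t) auto
next
  case False
  define n where "n = real (card X)"
  define \<sigma> where "\<sigma> = real (\<Sum>x \<in> X. f x)"
  have "\<sigma> > 0" unfolding \<sigma>_def using False by (simp only: of_nat_0_less_iff)
  moreover have "n > 0" using False assms by (auto simp: n_def card_gt_0_iff)
  ultimately have pos: "n > 0" "\<sigma> > 0" by auto
  have "n = (\<Sum>x \<in> X. 1 + t * (n * f x / \<sigma> - 1))"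
  proof -
    have "(\<Sum>x \<in> X. 1 + t * (n * f x / \<sigma> - 1)) = n + t * (n * (\<Sum>x \<in> X. real (f x)) / \<sigma> - n)"
      by (simp add: sum.distrib sum_distrib_left[symmetric] sum_subtractf sum_divide_distrib[symmetric] n_def)
    also have "(\<Sum>x \<in> X. real (f x)) = \<sigma>" by (simp add: \<sigma>_def)
    finally show ?thesis using pos by simp
  qed
  also have "\<dots> \<le> (\<Sum>x \<in> X. (1 + (n * f x / \<sigma> - 1)) ^ t)"
    using pos by (intro sum_mono Bernoulli_inequality) simp
  also have "\<dots> = n ^ t * (\<Sum>x \<in> X. real (f x) ^ t) / \<sigma> ^ t"
    by (simp add: power_mult_distrib power_divide sum_distrib_left sum_divide_distrib)
  finally have "n * \<sigma> ^ t \<le> n ^ t * (\<Sum>x \<in> X. real (f x) ^ t)"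
    using pos by (simp add: pos_le_divide_eq)
  then have "real (card X * (\<Sum>x \<in> X. f x) ^ t) \<le> real (card X ^ t * (\<Sum>x \<in> X. f x ^ t))"
    by (simp add: n_def \<sigma>_def)
  then show ?thesis by (simp only: of_nat_le_iff)
qed

lemma card_le_of_cover:
  assumes "finite I" "B \<subseteq> (\<Union>i \<in> I. A i)" "\<And>i. i \<in> I \<Longrightarrow> card (A i) \<le> m" "\<And>i. i \<in> I \<Longrightarrow> finite (A i)"
  shows "card B \<le> card I * m"
proof -
  have "card B \<le> card (\<Union>i \<in> I. A i)" using assms by (intro card_mono) auto
  also have "\<dots> \<le> (\<Sum>i \<in> I. card (A i))" by (rule card_UN_le[OF assms(1)])
  also have "\<dots> \<le> card I * m" using sum_bounded_above[of I "\<lambda>i. card (A i)" m] assms by simp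
  finally show ?thesis .
qed

lemma large_fibre:
  assumes "finite X" "finite Y" "Y \<noteq> {}" "f ` X \<subseteq> Y"
  shows "\<exists>y \<in> Y. card X \<le> card Y * card {x \<in> X. f x = y}"
proof (rule ccontr)
  assume contra: "\<not> ?thesis"
  have "card X \<le> (\<Sum>y \<in> Y. card {x \<in> X. f x = y})"
    using assms by (intro order.trans[OF card_mono card_UN_le]) auto
  then have "card Y * card X \<le> (\<Sum>y \<in> Y. card Y * card {x \<in> X. f x = y})"
    by (simp add: sum_distrib_left[symmetric])
  also have "\<dots> < (\<Sum>y \<in> Y. card X)"
    using contra assms by (intro sum_strict_mono) (auto simp: not_le)
  finally show False by simp
qed

lemma factor_large_of_prod_large:
  fixes a b :: "'i \<Rightarrow> nat"
  assumes "finite I" "\<And>i. i \<in> I \<Longrightarrow> a i \<le> b i" "\<And>i. i \<in> I \<Longrightarrow> 0 < b i"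
    and "(\<Prod>i \<in> I. b i) \<le> F * (\<Prod>i \<in> I. a i)" "i \<in> I"
  shows "b i \<le> F * a i"
proof -
  define R where "R = (\<Prod>j \<in> I - {i}. b j)"
  have "R > 0" using assms by (auto simp: R_def intro!: prod_pos)
  have "b i * R \<le> F * (a i * (\<Prod>j \<in> I - {i}. a j))"
    using assms by (simp add: R_def prod.remove[of I i])
  also have "\<dots> \<le> F * (a i * R)"
    using assms unfolding R_def by (intro mult_left_mono prod_mono) auto
  finally show ?thesis using \<open>R > 0\<close> by (simp add: mult.assoc[symmetric])
qed

section \<open>Dependent random choice\<close>

text \<open>
  The averaging behind dependent random choice. Counting pairs of a sample \<open>T\<close> and a tuple
  \<open>\<omega>\<close> with one entry in each \<open>A i\<close> that all of \<open>T\<close> is joined to, the tuple \<open>\<omega>\<close> receives the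
  \<open>t\<close>-th power of its number of common neighbours in \<open>B\<close>, so the power mean inequality applies.
  Working with the product of the sets \<open>A i\<close> is what later gives one sample that is
  good for all \<open>i\<close> at once.
\<close>

lemma sum_common_sample:
  fixes P :: "'i \<Rightarrow> 'u \<Rightarrow> 'r \<Rightarrow> bool"
  assumes I: "finite I" and A: "\<And>i. i \<in> I \<Longrightarrow> finite (A i)" and B: "finite B"
    and deg: "\<And>i r. i \<in> I \<Longrightarrow> r \<in> B \<Longrightarrow> card (A i) \<le> Q * card {u \<in> A i. P i u r}"
    and ne: "\<And>i. i \<in> I \<Longrightarrow> A i \<noteq> {}"
  shows "(\<Prod>i \<in> I. card (A i)) * card B ^ t \<le> Q ^ (card I * t) *
     (\<Sum>T | set T \<subseteq> B \<and> length T = t. \<Prod>i \<in> I. card {u \<in> A i. \<forall>r \<in> set T. P i u r})"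
proof -
  define W where "W = PiE I A"
  define n where "n = card W"
  have finW: "finite W" unfolding W_def using I A by (intro finite_PiE) auto
  have n: "n = (\<Prod>i \<in> I. card (A i))" unfolding n_def W_def using I by (rule card_PiE)
  have n0: "n > 0" unfolding n using ne A by (intro prod_pos) (auto simp: card_gt_0_iff)
  define Ts where "Ts = {T. set T \<subseteq> B \<and> length T = t}"
  have finTs: "finite Ts" unfolding Ts_def by (rule finite_lists_length_eq[OF B])
  define f where "f \<omega> = card {r \<in> B. \<forall>i \<in> I. P i (\<omega> i) r}" for \<omega>
  have PiE_filter: "card {\<omega> \<in> W. \<forall>i \<in> I. X i (\<omega> i)} = (\<Prod>i \<in> I. card {u \<in> A i. X i u})" for X
  proof -
    have "{\<omega> \<in> W. \<forall>i \<in> I. X i (\<omega> i)} = PiE I (\<lambda>i. {u \<in> A i. X i u})"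
      by (auto simp: W_def PiE_iff extensional_def)
    then show ?thesis using I by (simp add: card_PiE)
  qed
  have "n * card B \<le> Q ^ card I * (\<Sum>\<omega> \<in> W. f \<omega>)"
  proof -
    have "n * card B = (\<Sum>r \<in> B. n)" by simp
    also have "\<dots> \<le> (\<Sum>r \<in> B. Q ^ card I * card {\<omega> \<in> W. \<forall>i \<in> I. P i (\<omega> i) r})"
    proof (rule sum_mono)
      fix r assume "r \<in> B"
      have "n \<le> (\<Prod>i \<in> I. Q * card {u \<in> A i. P i u r})"
        unfolding n using deg \<open>r \<in> B\<close> by (intro prod_mono) auto
      then show "n \<le> Q ^ card I * card {\<omega> \<in> W. \<forall>i \<in> I. P i (\<omega> i) r}"
        using PiE_filter[of "\<lambda>i u. P i u r"] by (simp add: prod.distrib)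
    qed
    also have "\<dots> = Q ^ card I * (\<Sum>\<omega> \<in> W. f \<omega>)"
      unfolding sum_distrib_left[symmetric] f_def
      using double_count[OF B finW, of "\<lambda>r \<omega>. \<forall>i \<in> I. P i (\<omega> i) r"] by simp
    finally show ?thesis .
  qed
  then have "n * (n * card B) ^ t \<le> n * (Q ^ card I * (\<Sum>\<omega> \<in> W. f \<omega>)) ^ t"
    by (intro mult_left_mono power_mono) auto
  also have "\<dots> = Q ^ (card I * t) * (n * (\<Sum>\<omega> \<in> W. f \<omega>) ^ t)"
    by (simp add: power_mult_distrib power_mult)
  also have "\<dots> \<le> Q ^ (card I * t) * (n ^ t * (\<Sum>\<omega> \<in> W. f \<omega> ^ t))"
    using power_mean[OF finW, of f t] by (simp add: n_def)
  finally have "n ^ t * (n * card B ^ t) \<le> n ^ t * (Q ^ (card I * t) * (\<Sum>\<omega> \<in> W. f \<omega> ^ t))"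
    by (simp add: power_mult_distrib algebra_simps)
  then have "n * card B ^ t \<le> Q ^ (card I * t) * (\<Sum>\<omega> \<in> W. f \<omega> ^ t)"
    using n0 by simp
  also have "(\<Sum>\<omega> \<in> W. f \<omega> ^ t) = (\<Sum>\<omega> \<in> W. card {T \<in> Ts. \<forall>i \<in> I. \<forall>r \<in> set T. P i (\<omega> i) r})"
  proof (rule sum.cong[OF refl])
    fix \<omega>
    have "{T \<in> Ts. \<forall>i \<in> I. \<forall>r \<in> set T. P i (\<omega> i) r}
        = {T. set T \<subseteq> {r \<in> B. \<forall>i \<in> I. P i (\<omega> i) r} \<and> length T = t}"
      by (auto simp: Ts_def)
    then show "f \<omega> ^ t = card {T \<in> Ts. \<forall>i \<in> I. \<forall>r \<in> set T. P i (\<omega> i) r}"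
      using B by (simp add: f_def card_lists_length_eq)
  qed
  also have "\<dots> = (\<Sum>T \<in> Ts. card {\<omega> \<in> W. \<forall>i \<in> I. \<forall>r \<in> set T. P i (\<omega> i) r})"
    by (rule double_count[OF finW finTs])
  also have "\<dots> = (\<Sum>T \<in> Ts. \<Prod>i \<in> I. card {u \<in> A i. \<forall>r \<in> set T. P i u r})"
    using PiE_filter[of "\<lambda>i u. \<forall>r \<in> set _. P i u r"] by simp
  finally show ?thesis by (simp add: n Ts_def)
qed

text \<open>
  For random \<open>T\<close>, let \<open>A' i\<close> be the part of \<open>A i\<close> joined to all of \<open>T\<close>. A set \<open>S\<close> of at most \<open>l\<close> vertices
  with fewer than \<open>m\<close> common neighbours survives only if \<open>T\<close> lies among these, and there are too few such
  samples, over all \<open>S\<close>, to account for the average product of the sizes of the sets \<open>A' i\<close>. A sample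
  without bad sets and with half the average product remains; none of the factors can then be small.
\<close>

lemma dependent_random_choice:
  fixes P :: "'i \<Rightarrow> 'u \<Rightarrow> 'r \<Rightarrow> bool"
  assumes I: "finite I" and A: "\<And>i. i \<in> I \<Longrightarrow> finite (A i)" "\<And>i. i \<in> I \<Longrightarrow> A i \<noteq> {}"
    and R: "finite R" "m \<le> card R" and B: "B \<subseteq> R"
    and deg: "\<And>i r. i \<in> I \<Longrightarrow> r \<in> B \<Longrightarrow> card (A i) \<le> Q * card {u \<in> A i. P i u r}"
    and few: "(\<Sum>i \<in> I. card (A i)) ^ l * m ^ t * (2 * Q ^ (card I * t)) < card B ^ t"
  obtains A' where "\<And>i. i \<in> I \<Longrightarrow> A' i \<subseteq> A i"
    "\<And>i. i \<in> I \<Longrightarrow> card (A i) \<le> 2 * Q ^ (card I * t) * card (A' i)"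
    "\<And>S. S \<subseteq> Sigma I A' \<Longrightarrow> card S \<le> l \<Longrightarrow> m \<le> card {r \<in> R. \<forall>(i, u) \<in> S. P i u r}"
proof -
  define F where "F = 2 * Q ^ (card I * t)"
  define n where "n = (\<Prod>i \<in> I. card (A i))"
  have n0: "n > 0" unfolding n_def using A by (intro prod_pos) (auto simp: card_gt_0_iff)
  have finB: "finite B" using R B finite_subset by blast
  define Ts where "Ts = {T. set T \<subseteq> B \<and> length T = t}"
  have finTs: "finite Ts" and cTs: "card Ts = card B ^ t"
    unfolding Ts_def using finB by (auto intro: finite_lists_length_eq card_lists_length_eq)
  define A' where "A' T i = {u \<in> A i. \<forall>r \<in> set T. P i u r}" for T i
  define Z where "Z S = {r \<in> R. \<forall>(i, u) \<in> S. P i u r}" for S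
  define Ls where "Ls = {L. set L \<subseteq> Sigma I A \<and> length L = l}"
  have finS: "finite (Sigma I A)" using I A by auto
  have finLs: "finite Ls" and cLs: "card Ls = (\<Sum>i \<in> I. card (A i)) ^ l"
    unfolding Ls_def using finS I A
    by (auto intro: finite_lists_length_eq simp: card_lists_length_eq)
  define bad where "bad T \<longleftrightarrow> (\<exists>L \<in> Ls. set L \<subseteq> Sigma I (A' T) \<and> card (Z (set L)) < m)" for T
  have "{T \<in> Ts. bad T} \<subseteq> (\<Union>L \<in> {L \<in> Ls. card (Z (set L)) < m}. {T. set T \<subseteq> Z (set L) \<and> length T = t})"
    using B by (fastforce simp: bad_def A'_def Z_def Ts_def)
  then have "card {T \<in> Ts. bad T} \<le> card {L \<in> Ls. card (Z (set L)) < m} * m ^ t"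
  proof (rule card_le_of_cover[rotated])
    fix L assume L: "L \<in> {L \<in> Ls. card (Z (set L)) < m}"
    have finZ: "finite (Z (set L))" using R by (simp add: Z_def)
    show "card {T. set T \<subseteq> Z (set L) \<and> length T = t} \<le> m ^ t"
      using L finZ by (auto simp: card_lists_length_eq intro!: power_mono)
    show "finite {T. set T \<subseteq> Z (set L) \<and> length T = t}" using finite_lists_length_eq[OF finZ] .
  qed (use finLs in simp)
  also have "\<dots> \<le> card Ls * m ^ t" using finLs by (intro mult_right_mono card_mono) auto
  finally have "card {T \<in> Ts. bad T} * F \<le> card Ls * m ^ t * F" by simp
  also have "\<dots> < card B ^ t" using few by (simp add: cLs F_def)
  finally have few_bad: "card {T \<in> Ts. bad T} * F < card B ^ t" .
  have "\<exists>T \<in> Ts. \<not> bad T \<and> n \<le> F * (\<Prod>i \<in> I. card (A' T i))"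
  proof (rule ccontr)
    assume contra: "\<not> ?thesis"
    have "2 * (n * card B ^ t) \<le> F * (\<Sum>T \<in> Ts. \<Prod>i \<in> I. card (A' T i))"
      using sum_common_sample[OF I A(1) finB deg A(2), where t = t]
      by (simp add: F_def n_def Ts_def A'_def)
    also have "\<dots> = (\<Sum>T \<in> Ts. F * (\<Prod>i \<in> I. card (A' T i)))" by (simp add: sum_distrib_left)
    also have "\<dots> \<le> (\<Sum>T \<in> Ts. n + (if bad T then F * n else 0))"
    proof (rule sum_mono)
      fix T assume T: "T \<in> Ts"
      have "(\<Prod>i \<in> I. card (A' T i)) \<le> n"
        unfolding n_def A'_def using A by (intro prod_mono) (auto intro: card_mono)
      then have "F * (\<Prod>i \<in> I. card (A' T i)) \<le> F * n" by (rule mult_left_mono) simp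
      then have "F * (\<Prod>i \<in> I. card (A' T i)) \<le> n + F * n" by linarith
      with contra T show "F * (\<Prod>i \<in> I. card (A' T i)) \<le> n + (if bad T then F * n else 0)"
        by (cases "bad T") auto
    qed
    also have "\<dots> = n * card B ^ t + n * (card {T \<in> Ts. bad T} * F)"
      using finTs by (simp add: sum.distrib sum.If_cases cTs Int_def)
    also have "\<dots> < n * card B ^ t + n * card B ^ t" using few_bad n0 by simp
    finally show False by simp
  qed
  then obtain T where T: "T \<in> Ts" "\<not> bad T" "n \<le> F * (\<Prod>i \<in> I. card (A' T i))" by blast
  show ?thesis
  proof (rule that[of "A' T"])
    show "A' T i \<subseteq> A i" for i by (auto simp: A'_def)
    show "card (A i) \<le> 2 * Q ^ (card I * t) * card (A' T i)" if "i \<in> I" for i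
      using factor_large_of_prod_large[OF I _ _ T(3)[unfolded n_def] that] A
      by (auto simp: F_def A'_def card_gt_0_iff intro: card_mono)
    fix S assume S: "S \<subseteq> Sigma I (A' T)" "card S \<le> l"
    show "m \<le> card {r \<in> R. \<forall>(i, u) \<in> S. P i u r}"
    proof (cases "S = {}")
      case True
      then show ?thesis using R by simp
    next
      case False
      have SA: "S \<subseteq> Sigma I A" using S(1) by (auto simp: A'_def)
      then have "finite S" using finS finite_subset by blast
      then obtain xs where xs: "set xs = S" "length xs = card S"
        using finite_distinct_list distinct_card by metis
      \<comment> \<open>Bad sets were counted as lists of length exactly \<open>l\<close>, so \<open>S\<close> is listed with repetitions.\<close>
      have "set (xs @ replicate (l - card S) (hd xs)) = S"
        using xs False by (cases xs) (auto split: if_splits)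
      moreover have "length (xs @ replicate (l - card S) (hd xs)) = l" using xs S(2) by simp
      ultimately obtain L where "set L = S" "length L = l" by blast
      then show ?thesis using T(2) S(1) SA by (force simp: bad_def Ls_def Z_def not_less)
    qed
  qed
qed

section \<open>Uniform colours between large sets of copies\<close>

text \<open>
  Outside a small exceptional set, a vertex \<open>r\<close> sees a quarter of each \<open>A x\<close>, hence a fraction
  \<open>1 / (4 * q)\<close> of it in its most popular colour. The vector of popular colours takes at most
  \<open>q ^ \<Delta>\<close> values, so it is constant on a large set, to which dependent random choice applies.
\<close>

lemma uniform_colours_at_vertex:
  fixes col :: "'x \<Rightarrow> nat \<Rightarrow> nat \<Rightarrow> nat"
  assumes balanced: "\<And>A. A \<subseteq> {..<N} \<Longrightarrow>
      card {r \<in> {..<N}. 4 * card {u \<in> A. adj u r} < card A} * card A \<le> 4 * N"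
    and I: "finite I" "card I \<le> \<Delta>" and \<Delta>: "\<Delta> > 0"
    and A: "\<And>x. x \<in> I \<Longrightarrow> A x \<subseteq> {..<N}" "\<And>x. x \<in> I \<Longrightarrow> 8 * \<Delta> \<le> card (A x)"
    and q: "q > 0" and m: "m \<le> N"
    and col: "\<And>x u r. x \<in> I \<Longrightarrow> u < N \<Longrightarrow> r < N \<Longrightarrow> adj u r \<Longrightarrow> col x u r < q"
    and few: "(\<Delta> * N) ^ l * m ^ t * (2 * (4 * q) ^ (\<Delta> * t)) * (2 * q ^ \<Delta>) ^ t < N ^ t"
  obtains c A' where "\<And>x. x \<in> I \<Longrightarrow> c x < q" "\<And>x. x \<in> I \<Longrightarrow> A' x \<subseteq> A x"
    "\<And>x. x \<in> I \<Longrightarrow> card (A x) \<le> 2 * (4 * q) ^ (\<Delta> * t) * card (A' x)"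
    "\<And>S. S \<subseteq> Sigma I A' \<Longrightarrow> card S \<le> l \<Longrightarrow>
       m \<le> card {r \<in> {..<N}. \<forall>(x, u) \<in> S. adj u r \<and> col x u r = c x}"
proof -
  have finA: "finite (A x)" if "x \<in> I" for x using A(1)[OF that] finite_subset by blast
  define exc where "exc x = {r \<in> {..<N}. 4 * card {u \<in> A x. adj u r} < card (A x)}" for x
  define G where "G = {..<N} - (\<Union>x \<in> I. exc x)"
  have "card (\<Union>x \<in> I. exc x) \<le> card I * (N div (2 * \<Delta>))"
  proof (rule card_le_of_cover[OF I(1) order.refl])
    fix x assume x: "x \<in> I"
    have "card (exc x) * (8 * \<Delta>) \<le> card (exc x) * card (A x)" using A(2)[OF x] by simp
    also have "\<dots> \<le> 4 * N" unfolding exc_def by (rule balanced[OF A(1)[OF x]])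
    finally have "card (exc x) * (2 * \<Delta>) \<le> N" by linarith
    then show "card (exc x) \<le> N div (2 * \<Delta>)" using \<Delta> by (simp only: less_eq_div_iff_mult_less_eq)
  qed (simp add: exc_def)
  also have "\<dots> \<le> \<Delta> * (N div (2 * \<Delta>))" using I(2) by simp
  also have "\<dots> = \<Delta> * (N div 2 div \<Delta>)" by (simp add: div_mult2_eq)
  also have "\<dots> \<le> N div 2" by simp
  finally have "2 * card (\<Union>x \<in> I. exc x) \<le> N" by linarith
  moreover have "card G = N - card (\<Union>x \<in> I. exc x)"
    unfolding G_def using I by (subst card_Diff_subset) (auto simp: exc_def)
  ultimately have G: "N \<le> 2 * card G" by linarith
  have finG: "finite G" and GN: "G \<subseteq> {..<N}" by (auto simp: G_def)
  have "\<exists>c \<in> {..<q}. card (A x) \<le> 4 * q * card {u \<in> A x. adj u r \<and> col x u r = c}"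
    if x: "x \<in> I" and r: "r \<in> G" for x r
  proof -
    have "(\<lambda>u. col x u r) ` {u \<in> A x. adj u r} \<subseteq> {..<q}"
      using col[OF x] A(1)[OF x] r GN by auto
    then obtain c where "c < q" "card {u \<in> A x. adj u r} \<le> q * card {u \<in> {u \<in> A x. adj u r}. col x u r = c}"
      using large_fibre[of "{u \<in> A x. adj u r}" "{..<q}" "\<lambda>u. col x u r"] finA[OF x] q by auto
    moreover have "card (A x) \<le> 4 * card {u \<in> A x. adj u r}" using x r by (auto simp: G_def exc_def)
    moreover have "{u \<in> {u \<in> A x. adj u r}. col x u r = c} = {u \<in> A x. adj u r \<and> col x u r = c}"
      by auto
    ultimately show ?thesis by (intro bexI[of _ c]) auto
  qed
  note popular = this
  define maj where "maj x r = (SOME c. c < q \<and>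
      card (A x) \<le> 4 * q * card {u \<in> A x. adj u r \<and> col x u r = c})" for x r
  have maj: "maj x r < q \<and> card (A x) \<le> 4 * q * card {u \<in> A x. adj u r \<and> col x u r = maj x r}"
    if "x \<in> I" "r \<in> G" for x r
    unfolding maj_def by (rule someI_ex) (use popular[OF that] in blast)
  define pat where "pat r = restrict (\<lambda>x. maj x r) I" for r
  have "pat ` G \<subseteq> PiE I (\<lambda>_. {..<q})" using maj by (auto simp: pat_def)
  then have "\<exists>c \<in> PiE I (\<lambda>_. {..<q}). card G \<le> card (PiE I (\<lambda>_. {..<q})) * card {r \<in> G. pat r = c}"
    using finG I q by (intro large_fibre) (auto intro!: finite_PiE simp: PiE_eq_empty_iff)
  then obtain c where c: "c \<in> PiE I (\<lambda>_. {..<q})" "card G \<le> q ^ card I * card {r \<in> G. pat r = c}"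
    using I by (auto simp: card_PiE)
  define B where "B = {r \<in> G. pat r = c}"
  have BN: "B \<subseteq> {..<N}" using GN by (auto simp: B_def)
  have powI: "b ^ (card I * j) \<le> b ^ (\<Delta> * j)" if "b > 0" for b j :: nat
    using that I(2) by (intro power_increasing) auto
  have NB: "N \<le> 2 * q ^ \<Delta> * card B"
  proof -
    have "card G \<le> q ^ \<Delta> * card B"
      using c(2) powI[of q 1] q by (auto simp: B_def intro: order.trans mult_right_mono)
    then show ?thesis using G by linarith
  qed
  show ?thesis
  proof (rule dependent_random_choice[of I A "{..<N}" m B "4 * q" "\<lambda>x u r. adj u r \<and> col x u r = c x" l t])
    show "finite (A i)" if "i \<in> I" for i using finA[OF that] .
    show "A i \<noteq> {}" if "i \<in> I" for i using A(2)[OF that] \<Delta> by auto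
    show "card (A i) \<le> 4 * q * card {u \<in> A i. adj u r \<and> col i u r = c i}" if "i \<in> I" "r \<in> B" for i r
      using maj[of i r] that by (auto simp: B_def pat_def)
    have "(\<Sum>i \<in> I. card (A i)) \<le> card I * N"
      using sum_bounded_above[of I "\<lambda>i. card (A i)" N] A(1) card_mono[of "{..<N}"] by fastforce
    also have "\<dots> \<le> \<Delta> * N" using I by simp
    finally have "(\<Sum>i \<in> I. card (A i)) ^ l \<le> (\<Delta> * N) ^ l" by (rule power_mono) simp
    then have "(\<Sum>i \<in> I. card (A i)) ^ l * m ^ t * (2 * (4 * q) ^ (card I * t)) * (2 * q ^ \<Delta>) ^ t
        \<le> (\<Delta> * N) ^ l * m ^ t * (2 * (4 * q) ^ (\<Delta> * t)) * (2 * q ^ \<Delta>) ^ t"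
      using powI[of "4 * q" t] q by (intro mult_mono) auto
    also have "\<dots> < N ^ t" by (rule few)
    also have "\<dots> \<le> card B ^ t * (2 * q ^ \<Delta>) ^ t"
      using power_mono[OF NB, of t] by (simp add: power_mult_distrib algebra_simps)
    finally show "(\<Sum>i \<in> I. card (A i)) ^ l * m ^ t * (2 * (4 * q) ^ (card I * t)) < card B ^ t"
      by (simp only: mult_less_cancel2)
    fix A' assume A': "\<And>i. i \<in> I \<Longrightarrow> A' i \<subseteq> A i"
      "\<And>i. i \<in> I \<Longrightarrow> card (A i) \<le> 2 * (4 * q) ^ (card I * t) * card (A' i)"
      "\<And>S. S \<subseteq> Sigma I A' \<Longrightarrow> card S \<le> l \<Longrightarrow>
         m \<le> card {r \<in> {..<N}. \<forall>(x, u) \<in> S. adj u r \<and> col x u r = c x}"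
    show thesis
    proof (rule that[of c A'])
      show "c x < q" if "x \<in> I" for x using c(1) that by auto
      show "card (A x) \<le> 2 * (4 * q) ^ (\<Delta> * t) * card (A' x)" if "x \<in> I" for x
        using A'(2)[OF that] powI[of "4 * q" t] q
        by (meson order.trans mult_le_mono mult_pos_pos order.refl zero_less_numeral)
    qed (use A' in auto)
  qed (use I m BN in auto)
qed

text \<open>
  The vertices \<open>y\<close> are treated one after the other. What was achieved for \<open>y\<close> is inherited by smaller
  sets \<open>A x\<close>, and a fixed \<open>A x\<close> shrinks only at the at most \<open>\<Delta>\<close> steps with \<open>x\<close> in \<open>nb y\<close>.
\<close>

lemma uniform_colours:
  fixes col :: "'y \<Rightarrow> 'x \<Rightarrow> nat \<Rightarrow> nat \<Rightarrow> nat"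
  assumes balanced: "\<And>A. A \<subseteq> {..<N} \<Longrightarrow>
      card {r \<in> {..<N}. 4 * card {u \<in> A. adj u r} < card A} * card A \<le> 4 * N"
    and Y: "finite Y" "\<And>y. y \<in> Y \<Longrightarrow> finite (nb y)" "\<And>y. y \<in> Y \<Longrightarrow> card (nb y) \<le> \<Delta>"
      "\<And>x. card {y \<in> Y. x \<in> nb y} \<le> \<Delta>"
    and \<Delta>: "\<Delta> > 0" and q: "q > 0" and m: "m \<le> N"
    and col: "\<And>y x u r. y \<in> Y \<Longrightarrow> x \<in> nb y \<Longrightarrow> u < N \<Longrightarrow> r < N \<Longrightarrow> adj u r \<Longrightarrow> col y x u r < q"
    and F: "F = 2 * (4 * q) ^ (\<Delta> * t)" "8 * \<Delta> * F ^ \<Delta> \<le> N"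
    and few: "(\<Delta> * N) ^ l * m ^ t * F * (2 * q ^ \<Delta>) ^ t < N ^ t"
  obtains A c where "\<And>x. A x \<subseteq> {..<N}" "\<And>x. N \<le> F ^ \<Delta> * card (A x)"
    "\<And>y x. y \<in> Y \<Longrightarrow> x \<in> nb y \<Longrightarrow> c y x < q"
    "\<And>y S. y \<in> Y \<Longrightarrow> S \<subseteq> Sigma (nb y) A \<Longrightarrow> card S \<le> l \<Longrightarrow>
       m \<le> card {r \<in> {..<N}. \<forall>(x, u) \<in> S. adj u r \<and> col y x u r = c y x}"
proof -
  have F0: "F > 0" using q by (simp add: F)
  define good where "good Y' A c \<longleftrightarrow>
      (\<forall>x. A x \<subseteq> {..<N} \<and> N \<le> F ^ card {y \<in> Y'. x \<in> nb y} * card (A x)) \<and>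
      (\<forall>y \<in> Y'. (\<forall>x \<in> nb y. c y x < q) \<and> (\<forall>S. S \<subseteq> Sigma (nb y) A \<longrightarrow> card S \<le> l \<longrightarrow>
       m \<le> card {r \<in> {..<N}. \<forall>(x, u) \<in> S. adj u r \<and> col y x u r = c y x}))"
    for Y' and A :: "'x \<Rightarrow> nat set" and c
  have goodD: "\<And>x. A x \<subseteq> {..<N}" "\<And>x. N \<le> F ^ card {y \<in> Y'. x \<in> nb y} * card (A x)"
      "\<And>y x. y \<in> Y' \<Longrightarrow> x \<in> nb y \<Longrightarrow> c y x < q"
      "\<And>y S. y \<in> Y' \<Longrightarrow> S \<subseteq> Sigma (nb y) A \<Longrightarrow> card S \<le> l \<Longrightarrow>
          m \<le> card {r \<in> {..<N}. \<forall>(x, u) \<in> S. adj u r \<and> col y x u r = c y x}"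
    if "good Y' A c" for Y' A c
    using that unfolding good_def by blast+
  have "\<exists>A c. good Y' A c" if "finite Y'" "Y' \<subseteq> Y" for Y'
    using that
  proof (induction Y' rule: finite_induct)
    case empty
    show ?case by (intro exI[of _ "\<lambda>_. {..<N}"]) (auto simp: good_def)
  next
    case (insert y Y')
    then obtain A c where "good Y' A c" by blast
    note A = goodD(1,2)[OF this] and c = goodD(3,4)[OF this]
    have y: "y \<in> Y" "Y' \<subseteq> Y" using insert.prems by auto
    have big: "8 * \<Delta> \<le> card (A x)" for x
    proof -
      have "card {y \<in> Y'. x \<in> nb y} \<le> card {y \<in> Y. x \<in> nb y}"
        using y Y(1) by (intro card_mono) auto
      then have "F ^ card {y \<in> Y'. x \<in> nb y} \<le> F ^ \<Delta>"
        using F0 Y(4)[of x] by (intro power_increasing) auto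
      then have "F ^ \<Delta> * (8 * \<Delta>) \<le> F ^ \<Delta> * card (A x)"
        using F(2) A(2)[of x] by (metis le_trans mult.commute mult_le_mono1)
      then show ?thesis using F0 by simp
    qed
    obtain c' A' where c': "\<And>x. x \<in> nb y \<Longrightarrow> c' x < q" and A': "\<And>x. x \<in> nb y \<Longrightarrow> A' x \<subseteq> A x"
      "\<And>x. x \<in> nb y \<Longrightarrow> card (A x) \<le> 2 * (4 * q) ^ (\<Delta> * t) * card (A' x)"
      "\<And>S. S \<subseteq> Sigma (nb y) A' \<Longrightarrow> card S \<le> l \<Longrightarrow>
         m \<le> card {r \<in> {..<N}. \<forall>(x, u) \<in> S. adj u r \<and> col y x u r = c' x}"
      using uniform_colours_at_vertex[where I = "nb y" and A = A and col = "col y" and N = N and adj = adj,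
          OF balanced Y(2)[OF y(1)] Y(3)[OF y(1)] \<Delta> A(1) big q m col[OF y(1)] few[unfolded F(1)]]
      by blast
    note A' = A'[folded F(1)]
    define A'' where "A'' x = (if x \<in> nb y then A' x else A x)" for x
    have sub: "A'' x \<subseteq> A x" for x using A'(1) by (simp add: A''_def)
    have "N \<le> F ^ card {y' \<in> insert y Y'. x \<in> nb y'} * card (A'' x)" for x
    proof (cases "x \<in> nb y")
      case True
      have "{y' \<in> insert y Y'. x \<in> nb y'} = insert y {y' \<in> Y'. x \<in> nb y'}" using True by auto
      then have "card {y' \<in> insert y Y'. x \<in> nb y'} = Suc (card {y' \<in> Y'. x \<in> nb y'})"
        using insert.hyps by simp
      moreover have "N \<le> F ^ card {y \<in> Y'. x \<in> nb y} * (F * card (A' x))"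
        using A(2)[of x] A'(2)[OF True] by (meson le_trans mult_le_mono2)
      ultimately show ?thesis using True by (simp add: A''_def mult.assoc mult.left_commute)
    next
      case False
      then have "{y' \<in> insert y Y'. x \<in> nb y'} = {y' \<in> Y'. x \<in> nb y'}" by auto
      then show ?thesis using False A(2)[of x] by (simp add: A''_def)
    qed
    moreover have "m \<le> card {r \<in> {..<N}. \<forall>(x, u) \<in> S. adj u r \<and> col y' x u r = (c(y := c')) y' x}"
      if "y' \<in> insert y Y'" "S \<subseteq> Sigma (nb y') A''" "card S \<le> l" for y' S
    proof (cases "y' = y")
      case True
      have "S \<subseteq> Sigma (nb y) A'" using that(2) True by (auto simp: A''_def)
      then show ?thesis using A'(3)[of S] that(3) True by simp
    next
      case False
      have "S \<subseteq> Sigma (nb y') A" using that(2) sub by blast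
      then show ?thesis using c(2)[of y' S] that False by simp
    qed
    ultimately show ?case
      using sub A(1) c(1) c' by (intro exI[of _ A''] exI[of _ "c(y := c')"]) (simp add: good_def, blast)
  qed
  from this[OF Y(1) order.refl] obtain A c where "good Y A c" by blast
  note A = goodD(1,2)[OF this] and c = goodD(3,4)[OF this]
  have "N \<le> F ^ \<Delta> * card (A x)" for x
  proof -
    have "F ^ card {y \<in> Y. x \<in> nb y} \<le> F ^ \<Delta>" using F0 Y(4)[of x] by (intro power_increasing) auto
    then show ?thesis using A(2)[of x] by (meson le_trans mult_le_mono1)
  qed
  then show ?thesis by (rule that[OF A(1) _ c])
qed

section \<open>Avoiding bad events with local dependence\<close>

text \<open>
  A local union bound: the number of events is unrestricted, but each coordinate \<open>a\<close> influences at most \<open>d\<close> of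
  them. The coordinates are fixed one by one, keeping the conditional probability of the event \<open>i\<close>
  below \<open>d ^ (- j)\<close>, where \<open>j\<close> counts the coordinates in \<open>N i\<close> that are still free. For a single event
  fewer than one in \<open>d\<close> values violate this, so the at most \<open>d\<close> events concerned leave a value
  for the current coordinate. At the end all probabilities are below one, that is, zero.
\<close>

lemma avoid_bad_events:
  assumes A: "finite A" and "\<And>a. a \<in> A \<Longrightarrow> finite (\<Omega> a)" and I: "finite I"
    and N: "\<And>i. i \<in> I \<Longrightarrow> N i \<subseteq> A"
    and B: "\<And>i. i \<in> I \<Longrightarrow> B i \<subseteq> PiE A \<Omega>"
    and dep: "\<And>i \<omega> \<omega>'. i \<in> I \<Longrightarrow> \<omega> \<in> B i \<Longrightarrow> \<omega>' \<in> PiE A \<Omega> \<Longrightarrow>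
      (\<And>a. a \<in> N i \<Longrightarrow> \<omega>' a = \<omega> a) \<Longrightarrow> \<omega>' \<in> B i"
    and deg: "\<And>a. a \<in> A \<Longrightarrow> card {i \<in> I. a \<in> N i} \<le> d"
    and small: "\<And>i. i \<in> I \<Longrightarrow> card (B i) * d ^ card (N i) < card (PiE A \<Omega>)"
    and ne: "PiE A \<Omega> \<noteq> {}"
  shows "\<exists>\<omega> \<in> PiE A \<Omega>. \<forall>i \<in> I. \<omega> \<notin> B i"
  using assms
proof (induction A arbitrary: N B rule: finite_induct)
  case empty
  have "B i = {}" if "i \<in> I" for i
    using empty.prems(7)[OF that] empty.prems(3,4)[OF that] finite_subset[OF empty.prems(4)[OF that]]
    by (auto simp: card_gt_0_iff)
  then show ?case by auto
next
  case (insert x A)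
  note fin = insert.prems(1) and IN = insert.prems(3) and IB = insert.prems(4)
    and Idep = insert.prems(5) and Ideg = insert.prems(6) and Ismall = insert.prems(7)
  define P where "P = PiE A \<Omega>"
  have finP: "finite P" unfolding P_def using insert.hyps fin by (intro finite_PiE) auto
  have finOx: "finite (\<Omega> x)" using fin by simp
  have neOx: "\<Omega> x \<noteq> {}" and neP: "P \<noteq> {}"
    using insert.prems(8) by (auto simp: P_def PiE_eq_empty_iff)
  have cP: "card (PiE (insert x A) \<Omega>) = card (\<Omega> x) * card P"
    using insert.hyps by (simp add: card_PiE P_def)
  have ext: "\<omega>(x := u) \<in> PiE (insert x A) \<Omega>" if "\<omega> \<in> P" "u \<in> \<Omega> x" for \<omega> u
    using that by (auto simp: P_def PiE_iff extensional_def)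
  define B' where "B' u i = {\<omega> \<in> P. \<omega>(x := u) \<in> B i}" for u i
  have cB: "card (B i) = (\<Sum>u \<in> \<Omega> x. card (B' u i))" if "i \<in> I" for i
  proof -
    have "B i = (\<Union>u \<in> \<Omega> x. (\<lambda>\<omega>. \<omega>(x := u)) ` B' u i)"
    proof safe
      fix \<omega> assume w: "\<omega> \<in> B i"
      then have w': "\<omega> \<in> PiE (insert x A) \<Omega>" using IB that by auto
      then have "\<omega>(x := undefined) \<in> P" "\<omega> x \<in> \<Omega> x"
        using insert.hyps by (auto simp: P_def PiE_iff extensional_def)
      moreover have "(\<omega>(x := undefined))(x := \<omega> x) = \<omega>" by simp
      ultimately show "\<omega> \<in> (\<Union>u \<in> \<Omega> x. (\<lambda>\<omega>. \<omega>(x := u)) ` B' u i)"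
        using w unfolding B'_def by (intro UN_I[of "\<omega> x"] image_eqI[of _ _ "\<omega>(x := undefined)"]) auto
    qed (auto simp: B'_def)
    also have "card \<dots> = (\<Sum>u \<in> \<Omega> x. card ((\<lambda>\<omega>. \<omega>(x := u)) ` B' u i))"
      using finOx finP by (intro card_UN_disjoint) (auto simp: B'_def fun_eq_iff dest!: spec[of _ x])
    also have "\<dots> = (\<Sum>u \<in> \<Omega> x. card (B' u i))"
    proof (intro sum.cong refl card_image inj_onI)
      fix u \<omega> \<omega>' assume "\<omega> \<in> B' u i" "\<omega>' \<in> B' u i" "\<omega>(x := u) = \<omega>'(x := u)"
      moreover from this have "\<omega> x = \<omega>' x"
        using insert.hyps by (auto simp: B'_def P_def PiE_iff extensional_def)
      ultimately show "\<omega> = \<omega>'" by (metis fun_upd_triv fun_upd_upd)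
    qed
    finally show ?thesis .
  qed
  \<comment> \<open>The values of the new coordinate that raise the probability of the event \<open>i\<close> too much.\<close>
  define H where "H i = {u \<in> \<Omega> x. card P \<le> card (B' u i) * d ^ (card (N i) - 1)}" for i
  define J where "J = {i \<in> I. x \<in> N i}"
  have finJ: "finite J" using I by (simp add: J_def)
  have H: "d * card (H i) < card (\<Omega> x)" if i: "i \<in> J" for i
  proof -
    have finN: "finite (N i)" using IN i insert.hyps finite_subset[of "N i" "insert x A"] by (auto simp: J_def)
    then have cN: "card (N i) = Suc (card (N i) - 1)" using i by (cases "card (N i)") (auto simp: J_def)
    have "card (H i) * card P = (\<Sum>u \<in> H i. card P)" by simp
    also have "\<dots> \<le> (\<Sum>u \<in> H i. card (B' u i) * d ^ (card (N i) - 1))"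
      by (rule sum_mono) (simp add: H_def)
    also have "\<dots> \<le> (\<Sum>u \<in> \<Omega> x. card (B' u i) * d ^ (card (N i) - 1))"
      using finOx by (intro sum_mono2) (auto simp: H_def)
    also have "\<dots> = card (B i) * d ^ (card (N i) - 1)"
      using i by (simp add: cB J_def sum_distrib_right)
    finally have "d * (card (H i) * card P) \<le> card (B i) * d ^ card (N i)"
      by (subst cN) (simp add: algebra_simps)
    also have "\<dots> < card (\<Omega> x) * card P" using Ismall i by (simp add: cP J_def)
    finally show ?thesis by (simp add: mult.assoc[symmetric])
  qed
  have "\<not> \<Omega> x \<subseteq> (\<Union>i \<in> J. H i)"
  proof
    assume "\<Omega> x \<subseteq> (\<Union>i \<in> J. H i)"
    then have le: "card (\<Omega> x) \<le> (\<Sum>i \<in> J. card (H i))"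
      using finOx finJ by (intro order.trans[OF card_mono card_UN_le]) (auto simp: H_def)
    show False
    proof (cases "J = {}")
      case True
      then show ?thesis using le neOx finOx by simp
    next
      case False
      have "d * card (\<Omega> x) \<le> (\<Sum>i \<in> J. d * card (H i))" using le by (simp add: sum_distrib_left[symmetric])
      also have "\<dots> < (\<Sum>i \<in> J. card (\<Omega> x))" using H finJ False by (intro sum_strict_mono) auto
      also have "\<dots> \<le> d * card (\<Omega> x)" using Ideg[of x] by (simp add: J_def)
      finally show False by simp
    qed
  qed
  then obtain u where u: "u \<in> \<Omega> x" "\<And>i. i \<in> J \<Longrightarrow> u \<notin> H i" by blast
  have "\<exists>\<omega> \<in> PiE A \<Omega>. \<forall>i \<in> I. \<omega> \<notin> B' u i"
  proof (rule insert.IH[where N = "\<lambda>i. N i - {x}"])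
    show "finite (\<Omega> a)" if "a \<in> A" for a using fin that by simp
    show "finite I" by fact
    show "N i - {x} \<subseteq> A" if "i \<in> I" for i using IN[OF that] by auto
    show "B' u i \<subseteq> PiE A \<Omega>" for i by (auto simp: B'_def P_def)
    show "\<omega>' \<in> B' u i" if "i \<in> I" "\<omega> \<in> B' u i" "\<omega>' \<in> PiE A \<Omega>" "\<And>a. a \<in> N i - {x} \<Longrightarrow> \<omega>' a = \<omega> a"
      for i \<omega> \<omega>'
    proof -
      have "\<omega>'(x := u) \<in> B i"
      proof (rule Idep[OF that(1), of "\<omega>(x := u)"])
        show "\<omega>(x := u) \<in> B i" using that(2) by (simp add: B'_def)
        show "\<omega>'(x := u) \<in> PiE (insert x A) \<Omega>" using that(3) ext[OF _ u(1)] by (simp add: P_def)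
      qed (use that(4) in auto)
      then show ?thesis using that(3) by (simp add: B'_def P_def)
    qed
    show "card {i \<in> I. a \<in> N i - {x}} \<le> d" if "a \<in> A" for a
    proof -
      have "card {i \<in> I. a \<in> N i - {x}} \<le> card {i \<in> I. a \<in> N i}" using I by (intro card_mono) auto
      then show ?thesis using Ideg[of a] that by simp
    qed
    show "PiE A \<Omega> \<noteq> {}" using neP by (simp add: P_def)
    show "card (B' u i) * d ^ card (N i - {x}) < card (PiE A \<Omega>)" if i: "i \<in> I" for i
    proof (cases "x \<in> N i")
      case True
      then have "i \<in> J" using i by (simp add: J_def)
      then show ?thesis using u(2)[of i] u(1) True by (simp add: H_def P_def not_le)
    next
      case False
      have "B' v i = B' u i" if v: "v \<in> \<Omega> x" for v
      proof -
        have "\<omega>(x := v') \<in> B i" if "\<omega> \<in> P" "v' \<in> \<Omega> x" "v'' \<in> \<Omega> x" "\<omega>(x := v'') \<in> B i" for v' v'' \<omega>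
          by (rule Idep[OF i that(4) ext[OF that(1,2)]]) (use False in auto)
        then show ?thesis using v u(1) by (auto simp: B'_def)
      qed
      then have "card (B i) = card (\<Omega> x) * card (B' u i)" by (simp add: cB[OF i])
      then have "card (\<Omega> x) * (card (B' u i) * d ^ card (N i)) < card (\<Omega> x) * card P"
        using Ismall[OF i] by (simp add: cP mult.assoc)
      then show ?thesis using False by (simp add: P_def)
    qed
  qed
  then obtain \<omega> where "\<omega> \<in> P" "\<And>i. i \<in> I \<Longrightarrow> \<omega> \<notin> B' u i"
    unfolding P_def by blast
  then have "\<omega>(x := u) \<in> PiE (insert x A) \<Omega>" "\<forall>i \<in> I. \<omega>(x := u) \<notin> B i"
    using ext u(1) by (auto simp only: B'_def mem_Collect_eq)
  then show ?case by blast
qed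

text \<open>
  Turns a bound on the choices for one coordinate, conditional on all others, into one on the density of
  \<open>E\<close>: exchanging the value at \<open>a\<close> of a member of \<open>E\<close> for a second value, while remembering the old one,
  is injective.
\<close>

lemma card_le_of_fibres:
  assumes A: "finite A" "\<And>a. a \<in> A \<Longrightarrow> finite (\<Omega> a)" and a: "a \<in> A" and E: "E \<subseteq> PiE A \<Omega>"
    and fibre: "\<And>\<omega>. \<omega> \<in> PiE A \<Omega> \<Longrightarrow> card {u \<in> \<Omega> a. \<omega>(a := u) \<in> E} \<le> G"
  shows "card E * card (\<Omega> a) \<le> G * card (PiE A \<Omega>)"
proof -
  have fin: "finite (PiE A \<Omega>)" using A by (rule finite_PiE)
  have upd: "\<omega>(a := u) \<in> PiE A \<Omega>" if "\<omega> \<in> PiE A \<Omega>" "u \<in> \<Omega> a" for \<omega> u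
    using that a by (auto simp: PiE_iff extensional_def)
  let ?\<Phi> = "\<lambda>(\<omega>, u). (\<omega>(a := u), \<omega> a)"
  have "card (E \<times> \<Omega> a) \<le> card (Sigma (PiE A \<Omega>) (\<lambda>\<omega>. {u \<in> \<Omega> a. \<omega>(a := u) \<in> E}))"
  proof (rule card_inj_on_le[of ?\<Phi>])
    show "inj_on ?\<Phi> (E \<times> \<Omega> a)"
    proof (rule inj_onI, clarify)
      fix \<omega> u \<omega>' u' assume h: "\<omega>(a := u) = \<omega>'(a := u')" "\<omega> a = \<omega>' a"
      have "\<omega> = (\<omega>(a := u))(a := \<omega> a)" by simp
      also have "\<dots> = \<omega>'" by (simp add: h)
      finally show "\<omega> = \<omega>' \<and> u = u'" using fun_cong[OF h(1), of a] by simp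
    qed
    show "?\<Phi> ` (E \<times> \<Omega> a) \<subseteq> Sigma (PiE A \<Omega>) (\<lambda>\<omega>. {u \<in> \<Omega> a. \<omega>(a := u) \<in> E})"
    proof (rule image_subsetI)
      fix p assume "p \<in> E \<times> \<Omega> a"
      then obtain \<omega> u where p: "p = (\<omega>, u)" "\<omega> \<in> E" "u \<in> \<Omega> a" by blast
      then have "\<omega> \<in> PiE A \<Omega>" using E by blast
      then show "?\<Phi> p \<in> Sigma (PiE A \<Omega>) (\<lambda>\<omega>. {u \<in> \<Omega> a. \<omega>(a := u) \<in> E})"
        using p a upd[of \<omega> u] by (simp add: PiE_mem)
    qed
    show "finite (Sigma (PiE A \<Omega>) (\<lambda>\<omega>. {u \<in> \<Omega> a. \<omega>(a := u) \<in> E}))"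
      using fin A(2)[OF a] by auto
  qed
  also have "\<dots> = (\<Sum>\<omega> \<in> PiE A \<Omega>. card {u \<in> \<Omega> a. \<omega>(a := u) \<in> E})"
    using fin A(2)[OF a] by (simp add: card_SigmaI)
  also have "\<dots> \<le> card (PiE A \<Omega>) * G" using sum_bounded_above[OF fibre] by simp
  finally show ?thesis by (simp add: card_cartesian_product mult.commute)
qed

text \<open>
  Picks the images \<open>\<omega> a\<close> of one side of the graph to be embedded. A vertex \<open>v\<close> on the other side, to be mapped
  to a copy of \<open>y\<close>, must be joined to the images of \<open>S v\<close> in the sense of \<open>g\<close>, and to no other image
  around \<open>y\<close>. Adding the prohibitions in increasing order of \<open>a\<close>, each of them keeps a quarter of the
  candidates for \<open>v\<close>, unless \<open>\<omega> a\<close> is one of the few vertices that are unbalanced with respect to the current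
  set of candidates. As this set does not depend on \<open>\<omega> a\<close>, the exception has small probability.
\<close>

lemma choose_spread_vertices:
  fixes A :: "'a :: linorder set" and Nb :: "'y \<Rightarrow> 'a set" and S :: "'v \<Rightarrow> 'a set"
    and g :: "'y \<Rightarrow> 'a \<Rightarrow> nat \<Rightarrow> nat \<Rightarrow> bool"
  assumes balanced: "\<And>Z. Z \<subseteq> {..<N} \<Longrightarrow>
      card {u \<in> {..<N}. 4 * card {r \<in> Z. \<not> adj u r} < card Z} * card Z \<le> 4 * N"
    and A: "finite A" and \<Omega>: "\<And>a. a \<in> A \<Longrightarrow> \<Omega> a \<subseteq> {..<N}" "\<And>a. a \<in> A \<Longrightarrow> card (\<Omega> a) = M"
    and Y: "finite Y" "\<And>y. y \<in> Y \<Longrightarrow> Nb y \<subseteq> A" "\<And>y. y \<in> Y \<Longrightarrow> card (Nb y) \<le> K"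
      "\<And>a. a \<in> A \<Longrightarrow> card {y \<in> Y. a \<in> Nb y} \<le> d"
    and V: "\<And>y. y \<in> Y \<Longrightarrow> finite (V y)" "\<And>y. y \<in> Y \<Longrightarrow> card (V y) \<le> w"
      "\<And>y v. y \<in> Y \<Longrightarrow> v \<in> V y \<Longrightarrow> S v \<subseteq> Nb y"
    and rich: "\<And>\<omega> y v. \<omega> \<in> PiE A \<Omega> \<Longrightarrow> y \<in> Y \<Longrightarrow> v \<in> V y \<Longrightarrow>
      m \<le> card {r \<in> {..<N}. \<forall>a \<in> S v. g y a (\<omega> a) r}"
    and G: "0 < m" "0 < d" "4 * N * 4 ^ K \<le> G * m" "w * K * G * d ^ K < M"
  obtains \<omega> where "\<omega> \<in> PiE A \<Omega>"
    "\<And>y v. y \<in> Y \<Longrightarrow> v \<in> V y \<Longrightarrow> m \<le> 4 ^ K *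
       card {r \<in> {..<N}. (\<forall>a \<in> S v. g y a (\<omega> a) r) \<and> (\<forall>a \<in> Nb y - S v. \<not> adj (\<omega> a) r)}"
proof -
  have fin\<Omega>: "finite (\<Omega> a)" if "a \<in> A" for a using \<Omega>(1)[OF that] finite_subset by blast
  have ne: "PiE A \<Omega> \<noteq> {}" using \<Omega>(2) G(4) by (fastforce simp: PiE_eq_empty_iff)
  have finP: "finite (PiE A \<Omega>)" using A fin\<Omega> by (rule finite_PiE)
  define Z where "Z y v \<omega> T =
      {r \<in> {..<N}. (\<forall>b \<in> S v. g y b (\<omega> b) r) \<and> (\<forall>b \<in> T. \<not> adj (\<omega> b) r)}" for y v \<omega> T
  \<comment> \<open>\<open>W y v a\<close> collects the prohibitions added before that of \<open>a\<close>; the event \<open>E y v a\<close> says that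
    there were still enough candidates for \<open>v\<close> before the latter, which removes more than three quarters
    of them.\<close>
  define W where "W y v a = {b \<in> Nb y - S v. b < a}" for y v a
  define E where "E y v a = {\<omega> \<in> PiE A \<Omega>. m \<le> 4 ^ K * card (Z y v \<omega> (W y v a)) \<and>
      4 * card {r \<in> Z y v \<omega> (W y v a). \<not> adj (\<omega> a) r} < card (Z y v \<omega> (W y v a))}" for y v a
  define B where "B y = (\<Union>v \<in> V y. \<Union>a \<in> Nb y - S v. E y v a)" for y
  have finE: "finite (E y v a)" for y v a unfolding E_def using finP by simp
  have cE: "card (E y v a) * M \<le> G * card (PiE A \<Omega>)"
    if y: "y \<in> Y" "v \<in> V y" and a: "a \<in> Nb y - S v" for y v a
  proof -
    have aA: "a \<in> A" using a Y(2)[OF y(1)] by auto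
    have "card (E y v a) * card (\<Omega> a) \<le> G * card (PiE A \<Omega>)"
    proof (rule card_le_of_fibres[OF A fin\<Omega> aA])
      show "E y v a \<subseteq> PiE A \<Omega>" by (auto simp: E_def)
      fix \<omega> assume \<omega>: "\<omega> \<in> PiE A \<Omega>"
      let ?Z = "Z y v \<omega> (W y v a)"
      have Zeq: "Z y v (\<omega>(a := u)) (W y v a) = ?Z" for u
      proof -
        have "(\<omega>(a := u)) b = \<omega> b" if "b \<in> S v \<union> W y v a" for b using that a by (auto simp: W_def)
        then show ?thesis unfolding Z_def by (intro Collect_cong conj_cong ball_cong refl) auto
      qed
      show "card {u \<in> \<Omega> a. \<omega>(a := u) \<in> E y v a} \<le> G"
      proof (cases "m \<le> 4 ^ K * card ?Z")
        case True
        have ZN: "?Z \<subseteq> {..<N}" by (auto simp: Z_def)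
        let ?X = "{u \<in> {..<N}. 4 * card {r \<in> ?Z. \<not> adj u r} < card ?Z}"
        have "card ?X * m \<le> card ?X * (4 ^ K * card ?Z)" using True by simp
        also have "\<dots> = card ?X * card ?Z * 4 ^ K" by simp
        also have "\<dots> \<le> 4 * N * 4 ^ K" by (intro mult_right_mono balanced[OF ZN]) simp
        also have "\<dots> \<le> G * m" by (rule G)
        finally have "card ?X \<le> G" using G(1) by simp
        moreover have "{u \<in> \<Omega> a. \<omega>(a := u) \<in> E y v a} \<subseteq> ?X"
          using \<Omega>(1)[OF aA] by (auto simp: E_def Zeq)
        moreover have "finite ?X" by simp
        ultimately show ?thesis by (meson card_mono le_trans)
      next
        case False
        then have "{u \<in> \<Omega> a. \<omega>(a := u) \<in> E y v a} = {}" by (auto simp: E_def Zeq)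
        then show ?thesis by (simp only: card.empty le0)
      qed
    qed
    then show ?thesis using \<Omega>(2)[OF aA] by simp
  qed
  have "\<exists>\<omega> \<in> PiE A \<Omega>. \<forall>y \<in> Y. \<omega> \<notin> B y"
  proof (rule avoid_bad_events[OF A fin\<Omega> Y(1) Y(2)])
    show "B y \<subseteq> PiE A \<Omega>" for y by (auto simp: B_def E_def)
    show "\<omega>' \<in> B y" if y: "y \<in> Y" and "\<omega> \<in> B y" and \<omega>': "\<omega>' \<in> PiE A \<Omega>"
      and eq: "\<And>a. a \<in> Nb y \<Longrightarrow> \<omega>' a = \<omega> a" for y \<omega> \<omega>'
    proof -
      obtain v a where va: "v \<in> V y" "a \<in> Nb y - S v" "\<omega> \<in> E y v a"
        using \<open>\<omega> \<in> B y\<close> by (auto simp: B_def)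
      have "Z y v \<omega>' (W y v a) = Z y v \<omega> (W y v a)"
        unfolding Z_def using eq V(3)[OF y va(1)] by (intro Collect_cong conj_cong ball_cong refl) (auto simp: W_def)
      then have "\<omega>' \<in> E y v a" using va \<omega>' eq[of a] by (simp add: E_def)
      then show ?thesis using va by (auto simp: B_def)
    qed
    show "card {y \<in> Y. a \<in> Nb y} \<le> d" if "a \<in> A" for a using Y(4)[OF that] .
    show "card (B y) * d ^ card (Nb y) < card (PiE A \<Omega>)" if y: "y \<in> Y" for y
    proof -
      have finNb: "finite (Nb y)" using Y(2)[OF y] A finite_subset by blast
      have "card (B y) \<le> (\<Sum>v \<in> V y. \<Sum>a \<in> Nb y - S v. card (E y v a))"
        unfolding B_def using V(1)[OF y] finNb
        by (intro order.trans[OF card_UN_le sum_mono] card_UN_le) auto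
      then have "card (B y) * M \<le> (\<Sum>v \<in> V y. \<Sum>a \<in> Nb y - S v. card (E y v a)) * M" by simp
      also have "\<dots> = (\<Sum>v \<in> V y. \<Sum>a \<in> Nb y - S v. card (E y v a) * M)"
        by (simp add: sum_distrib_right)
      also have "\<dots> \<le> (\<Sum>v \<in> V y. \<Sum>a \<in> Nb y - S v. G * card (PiE A \<Omega>))"
        by (intro sum_mono cE y)
      also have "\<dots> \<le> (\<Sum>v \<in> V y. K * (G * card (PiE A \<Omega>)))"
      proof (rule sum_mono)
        fix v
        have "card (Nb y - S v) \<le> K" using Y(3)[OF y] card_mono[OF finNb, of "Nb y - S v"] by auto
        then show "(\<Sum>a \<in> Nb y - S v. G * card (PiE A \<Omega>)) \<le> K * (G * card (PiE A \<Omega>))" by simp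
      qed
      also have "\<dots> \<le> w * (K * (G * card (PiE A \<Omega>)))" using V(2)[OF y] by simp
      finally have BM: "card (B y) * M \<le> w * K * G * card (PiE A \<Omega>)" by (simp add: mult.assoc)
      have "d ^ card (Nb y) \<le> d ^ K" using G(2) Y(3)[OF y] by (intro power_increasing) auto
      with BM have "card (B y) * M * d ^ card (Nb y) \<le> w * K * G * card (PiE A \<Omega>) * d ^ K"
        by (rule mult_mono) auto
      also have "\<dots> = w * K * G * d ^ K * card (PiE A \<Omega>)" by (simp add: algebra_simps)
      also have "\<dots> < M * card (PiE A \<Omega>)"
        using G(4) ne finP by (intro mult_strict_right_mono) (auto simp: card_gt_0_iff)
      finally have "M * (card (B y) * d ^ card (Nb y)) < M * card (PiE A \<Omega>)" by (simp add: algebra_simps)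
      then show ?thesis by simp
    qed
  qed (use ne in auto)
  then obtain \<omega> where \<omega>: "\<omega> \<in> PiE A \<Omega>" "\<And>y. y \<in> Y \<Longrightarrow> \<omega> \<notin> B y" by blast
  show ?thesis
  proof (rule that[OF \<omega>(1)])
    fix y v assume y: "y \<in> Y" and v: "v \<in> V y"
    have finNb: "finite (Nb y)" using Y(2)[OF y] A finite_subset by blast
    have cK: "card T \<le> K" if "T \<subseteq> Nb y - S v" for T
      using Y(3)[OF y] card_mono[OF finNb, of T] that by (meson Diff_subset le_trans subset_trans)
    have "m \<le> 4 ^ card T * card (Z y v \<omega> T)"
      if "finite T" "T \<subseteq> Nb y - S v" "\<And>a b. a \<in> T \<Longrightarrow> b \<in> Nb y - S v \<Longrightarrow> b < a \<Longrightarrow> b \<in> T" for T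
      using that
    proof (induction T rule: finite_linorder_max_induct)
      case empty
      then show ?case using rich[OF \<omega>(1) y v] by (simp add: Z_def)
    next
      case (insert b T)
      have IH: "m \<le> 4 ^ card T * card (Z y v \<omega> T)"
      proof (rule insert.IH)
        fix a c assume "a \<in> T" "c \<in> Nb y - S v" "c < a"
        then have "c \<in> insert b T" "c < b" using insert.prems(2)[of a c] insert.hyps by auto
        then show "c \<in> T" by auto
      qed (use insert.prems in auto)
      have T: "W y v b = T" using insert.prems insert.hyps(2) by (auto simp: W_def)
      have "(4::nat) ^ card T \<le> 4 ^ K" using cK[of T] insert.prems(1) by (intro power_increasing) auto
      then have "m \<le> 4 ^ K * card (Z y v \<omega> T)" using IH by (meson le_trans mult_le_mono1)
      moreover have "\<omega> \<notin> E y v b" using \<omega>(2)[OF y] v insert.prems(1) by (auto simp: B_def)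
      ultimately have "card (Z y v \<omega> T) \<le> 4 * card {r \<in> Z y v \<omega> T. \<not> adj (\<omega> b) r}"
        using \<omega>(1) by (simp add: E_def T not_less)
      also have "{r \<in> Z y v \<omega> T. \<not> adj (\<omega> b) r} = Z y v \<omega> (insert b T)" by (auto simp: Z_def)
      finally have "card (Z y v \<omega> T) \<le> 4 * card (Z y v \<omega> (insert b T))" .
      then have "m \<le> 4 ^ card T * (4 * card (Z y v \<omega> (insert b T)))"
        using IH by (meson le_trans mult_le_mono2)
      moreover have "b \<notin> T" using insert.hyps(2) by auto
      ultimately show ?case using insert.hyps(1) by simp
    qed
    from this[of "Nb y - S v"] have "m \<le> 4 ^ card (Nb y - S v) * card (Z y v \<omega> (Nb y - S v))"
      using finNb by auto
    moreover have "(4::nat) ^ card (Nb y - S v) \<le> 4 ^ K" using cK by (intro power_increasing) auto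
    ultimately have "m \<le> 4 ^ K * card (Z y v \<omega> (Nb y - S v))" by (meson le_trans mult_le_mono1)
    then show "m \<le> 4 ^ K *
       card {r \<in> {..<N}. (\<forall>a \<in> S v. g y a (\<omega> a) r) \<and> (\<forall>a \<in> Nb y - S v. \<not> adj (\<omega> a) r)}"
      by (simp add: Z_def)
  qed
qed

lemma disjoint_pieces:
  assumes "finite F" "M * card F \<le> card A"
  shows "\<exists>P. (\<forall>a \<in> F. P a \<subseteq> A \<and> card (P a) = M) \<and> (\<forall>a \<in> F. \<forall>b \<in> F. a \<noteq> b \<longrightarrow> P a \<inter> P b = {})"
  using assms
proof (induction F arbitrary: A rule: finite_induct)
  case empty
  show ?case by auto
next
  case (insert x F)
  have "M \<le> card A" using insert.prems insert.hyps by simp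
  then obtain B where B: "B \<subseteq> A" "card B = M" "finite B"
    by (rule obtain_subset_with_card_n)
  have "M * card F \<le> card (A - B)" using insert.prems insert.hyps B by (simp add: card_Diff_subset)
  from insert.IH[OF this] obtain P where P: "\<forall>a \<in> F. P a \<subseteq> A - B \<and> card (P a) = M"
      "\<forall>a \<in> F. \<forall>b \<in> F. a \<noteq> b \<longrightarrow> P a \<inter> P b = {}"
    by blast
  have PF: "P a \<subseteq> A - B" "card (P a) = M" if "a \<in> F" for a using P(1) that by auto
  have P': "(P(x := B)) a = P a" if "a \<in> F" for a using that insert.hyps by auto
  show ?case
  proof (intro exI[of _ "P(x := B)"] conjI ballI impI)
    fix a assume "a \<in> insert x F"
    then consider "a = x" | "a \<in> F" by blast
    then have "(P(x := B)) a \<subseteq> A \<and> card ((P(x := B)) a) = M"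
    proof cases
      case 1
      then show ?thesis using B by simp
    next
      case 2
      then show ?thesis using PF[of a] P'[of a] by auto
    qed
    then show "(P(x := B)) a \<subseteq> A" "card ((P(x := B)) a) = M" by auto
  next
    fix a b assume ab: "a \<in> insert x F" "b \<in> insert x F" "a \<noteq> b"
    then consider "a = x" "b \<in> F" | "a \<in> F" "b = x" | "a \<in> F" "b \<in> F" by blast
    then show "(P(x := B)) a \<inter> (P(x := B)) b = {}"
    proof cases
      case 1
      then show ?thesis using PF(1)[of b] P'[of b] by auto
    next
      case 2
      then show ?thesis using PF(1)[of a] P'[of a] by auto
    next
      case 3
      then show ?thesis using P(2) ab(3) P' by auto
    qed
  qed
qed

lemma distinct_representatives:
  assumes "finite F" "\<And>v. v \<in> F \<Longrightarrow> finite (R v)" "\<And>v. v \<in> F \<Longrightarrow> card F \<le> card (R v)"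
  shows "\<exists>\<rho>. inj_on \<rho> F \<and> (\<forall>v \<in> F. \<rho> v \<in> R v)"
  using assms
proof (induction F rule: finite_induct)
  case empty
  show ?case by auto
next
  case (insert x F)
  then obtain \<rho> where \<rho>: "inj_on \<rho> F" "\<forall>v \<in> F. \<rho> v \<in> R v"
    by (metis Suc_leD card_insert_disjoint insertCI)
  have "\<not> R x \<subseteq> \<rho> ` F"
  proof
    assume "R x \<subseteq> \<rho> ` F"
    then have "card (R x) \<le> card F" using insert.hyps(1) by (rule surj_card_le[rotated])
    then show False using insert.prems(2)[of x] insert.hyps by simp
  qed
  then obtain r where "r \<in> R x" "r \<notin> \<rho> ` F" by blast
  then show ?case using \<rho> insert.hyps
    by (intro exI[of _ "\<rho>(x := r)"]) (auto simp: inj_on_def)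
qed

section \<open>The blowup and its induced Ramsey property\<close>

lemma finite_edges:
  assumes "simple_graph G"
  shows "finite (edges G)"
proof (rule finite_subset)
  show "edges G \<subseteq> Pow (verts G)" using assms by (auto simp: simple_graph_def)
qed (use assms in \<open>simp add: simple_graph_def\<close>)

lemma neighbours_le_max_degree:
  assumes G: "simple_graph G" and \<Delta>: "max_degree G \<le> \<Delta>"
  shows "finite {u. {u, v} \<in> edges G}" "card {u. {u, v} \<in> edges G} \<le> \<Delta>"
proof -
  have sub: "{u. {u, v} \<in> edges G} \<subseteq> verts G" and fin: "finite (verts G)"
    using G by (auto simp: simple_graph_def doubleton_eq_iff)
  then show f: "finite {u. {u, v} \<in> edges G}" by (rule finite_subset)
  have finE: "finite (edges G)" by (rule finite_edges[OF G])
  show "card {u. {u, v} \<in> edges G} \<le> \<Delta>"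
  proof (cases "v \<in> verts G")
    case True
    have "card {u. {u, v} \<in> edges G} \<le> card {e \<in> edges G. v \<in> e}"
      using finE by (intro card_inj_on_le[of "\<lambda>u. {u, v}"]) (auto simp: inj_on_def doubleton_eq_iff)
    also have "\<dots> \<le> max_degree G" unfolding max_degree_def degree_def[symmetric]
      using True fin by (intro Max_ge) auto
    finally show ?thesis using \<Delta> by simp
  next
    case False
    then have "{u. {u, v} \<in> edges G} = {}" using G by (auto simp: simple_graph_def doubleton_eq_iff)
    then show ?thesis by (simp only: card.empty le0)
  qed
qed

lemma card_edges_le_max_degree:
  assumes G: "simple_graph G" and \<Delta>: "max_degree G \<le> \<Delta>"
  shows "card (edges G) \<le> \<Delta> * card (verts G)"
proof -
  have fin: "finite (verts G)" using G by (simp add: simple_graph_def)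
  have finE: "finite (edges G)" by (rule finite_edges[OF G])
  have "card (edges G) \<le> card (verts G) * \<Delta>"
  proof (rule card_le_of_cover[OF fin])
    show "edges G \<subseteq> (\<Union>v \<in> verts G. {e \<in> edges G. v \<in> e})"
    proof
      fix e assume e: "e \<in> edges G"
      then obtain u v where "e = {u, v}" "u \<in> verts G" using G unfolding simple_graph_def by blast
      then show "e \<in> (\<Union>v \<in> verts G. {e \<in> edges G. v \<in> e})" using e by blast
    qed
    fix v assume "v \<in> verts G"
    then have "degree G v \<le> max_degree G" unfolding max_degree_def using fin by (intro Max_ge) auto
    then show "card {e \<in> edges G. v \<in> e} \<le> \<Delta>" using \<Delta> by (simp add: degree_def)
  qed (use finE in simp)
  then show ?thesis by (simp add: mult.commute)
qed

lemma blowup_mono: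
  assumes "blowup r G' G" "r \<le> s"
  shows "blowup s G' G"
proof -
  obtain \<phi> where "\<phi> \<in> verts G' \<rightarrow> verts G"
    "\<forall>u v. {u, v} \<in> edges G' \<longrightarrow> {\<phi> u, \<phi> v} \<in> edges G"
    and le: "\<forall>v \<in> verts G. card {u \<in> verts G'. \<phi> u = v} \<le> r"
    using assms(1) unfolding blowup_def by blast
  moreover have "\<forall>v \<in> verts G. card {u \<in> verts G'. \<phi> u = v} \<le> s" using le assms(2) by force
  ultimately show ?thesis using assms(1) unfolding blowup_def by blast
qed

text \<open>
  Every edge of \<open>G\<close> carries the same relation \<open>adj\<close>, with its first argument at the end in \<open>X\<close>. Coding the
  copies by \<open>prod_encode\<close> keeps the vertices natural numbers, the type over which \<open>r_ind\<close> and
  \<open>size_r_ind\<close> minimise.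
\<close>

definition bipartite_blowup ::
    "nat graph \<Rightarrow> nat set \<Rightarrow> nat set \<Rightarrow> nat \<Rightarrow> (nat \<Rightarrow> nat \<Rightarrow> bool) \<Rightarrow> nat graph" where
  "bipartite_blowup G X Y N adj =
     Graph (prod_encode ` (verts G \<times> {..<N}))
       {{prod_encode (x, u), prod_encode (y, r)} | x u y r.
         x \<in> X \<and> y \<in> Y \<and> {x, y} \<in> edges G \<and> u < N \<and> r < N \<and> adj u r}"

lemma bipartite_blowup:
  fixes G :: "nat graph" and N :: nat and adj :: "nat \<Rightarrow> nat \<Rightarrow> bool"
  assumes G: "simple_graph G" and XY: "X \<union> Y = verts G" "X \<inter> Y = {}"
  defines "G' \<equiv> bipartite_blowup G X Y N adj"
  shows "blowup N G' G" "card (verts G') = N * card (verts G)"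
    "card (edges G') \<le> N\<^sup>2 * card (edges G)"
proof -
  have fin: "finite (verts G)" using G by (simp add: simple_graph_def)
  have "edges G' \<subseteq> {{u, v} | u v. u \<in> verts G' \<and> v \<in> verts G' \<and> u \<noteq> v}"
  proof
    fix e assume "e \<in> edges G'"
    then obtain x u y r where e: "e = {prod_encode (x, u), prod_encode (y, r)}"
      "x \<in> X" "y \<in> Y" "u < N" "r < N"
      by (auto simp: G'_def bipartite_blowup_def)
    moreover from this have "prod_encode (x, u) \<in> verts G'" "prod_encode (y, r) \<in> verts G'" "x \<noteq> y"
      using XY by (auto simp: G'_def bipartite_blowup_def)
    ultimately show "e \<in> {{u, v} | u v. u \<in> verts G' \<and> v \<in> verts G' \<and> u \<noteq> v}"
      by (intro CollectI exI[of _ "prod_encode (x, u)"] exI[of _ "prod_encode (y, r)"]) simp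
  qed
  then have "simple_graph G'"
    using fin by (simp add: simple_graph_def G'_def bipartite_blowup_def)
  moreover have "card {v \<in> verts G'. fst (prod_decode v) = g} \<le> N" for g
  proof -
    have "{v \<in> verts G'. fst (prod_decode v) = g} \<subseteq> (\<lambda>u. prod_encode (g, u)) ` {..<N}"
      by (auto simp: G'_def bipartite_blowup_def)
    then show ?thesis using surj_card_le[of "{..<N}"] by simp
  qed
  ultimately show "blowup N G' G"
    unfolding blowup_def
    by (intro conjI bexI[of _ "fst \<circ> prod_decode"])
      (auto simp: G'_def bipartite_blowup_def doubleton_eq_iff insert_commute)
  show "card (verts G') = N * card (verts G)"
    unfolding G'_def bipartite_blowup_def by (simp add: card_image inj_prod_encode card_cartesian_product)
  have finE: "finite (edges G)" by (rule finite_edges[OF G])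
  define mk where "mk = (\<lambda>(e, u, r). {prod_encode (THE x. x \<in> e \<inter> X, u), prod_encode (THE y. y \<in> e \<inter> Y, r)})"
  have "edges G' \<subseteq> mk ` (edges G \<times> {..<N} \<times> {..<N})"
  proof
    fix e' assume "e' \<in> edges G'"
    then obtain x u y r where e': "e' = {prod_encode (x, u), prod_encode (y, r)}"
      "x \<in> X" "y \<in> Y" "{x, y} \<in> edges G" "u < N" "r < N"
      by (auto simp: G'_def bipartite_blowup_def)
    have "(THE z. z \<in> {x, y} \<inter> X) = x" "(THE z. z \<in> {x, y} \<inter> Y) = y"
      using e'(2,3) XY(2) by (auto intro!: the_equality)
    then have "e' = mk ({x, y}, u, r)" by (simp add: mk_def e'(1))
    then show "e' \<in> mk ` (edges G \<times> {..<N} \<times> {..<N})" using e' by blast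
  qed
  then have "card (edges G') \<le> card (edges G \<times> {..<N} \<times> {..<N})"
    using finE by (intro surj_card_le) auto
  then show "card (edges G') \<le> N\<^sup>2 * card (edges G)"
    by (simp add: card_cartesian_product power2_eq_square algebra_simps)
qed

text \<open>
  Colouring \<open>{x, y}\<close> by the colour that \<open>uniform_colours\<close> provides turns a colouring of the blowup into one of \<open>G\<close>, which
  has a monochromatic copy of \<open>H\<close>. The vertices of \<open>H'\<close> lying above \<open>X\<close> are embedded first, so that every
  vertex lying above \<open>Y\<close> keeps at least \<open>w\<close> possible images; the latter do not interact except that
  those above the same \<open>y\<close> have to be distinct.
\<close>

lemma bipartite_blowup_arrows_ind:
  fixes H' :: "'c :: linorder graph"
  assumes balanced: "\<And>A. A \<subseteq> {..<N} \<Longrightarrow>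
      card {r \<in> {..<N}. 4 * card {u \<in> A. adj u r} < card A} * card A \<le> 4 * N"
    "\<And>Z. Z \<subseteq> {..<N} \<Longrightarrow>
      card {u \<in> {..<N}. 4 * card {r \<in> Z. \<not> adj u r} < card Z} * card Z \<le> 4 * N"
    and H: "simple_graph H" "max_degree H \<le> k"
    and G: "simple_graph G" "max_degree G \<le> \<Delta>"
    and XY: "X \<union> Y = verts G" "X \<inter> Y = {}" "\<And>e. e \<in> edges G \<Longrightarrow> \<exists>x \<in> X. \<exists>y \<in> Y. e = {x, y}"
    and arrows: "arrows G H q" and H': "blowup w H' H"
    and pos: "\<Delta> > 0" "q > 0" "m > 0" and m: "m \<le> N"
    and F: "F = 2 * (4 * q) ^ (\<Delta> * t)" "8 * \<Delta> * F ^ \<Delta> \<le> N"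
    and few: "(\<Delta> * N) ^ (k * w) * m ^ t * F * (2 * q ^ \<Delta>) ^ t < N ^ t"
    and M: "w * M * F ^ \<Delta> \<le> N"
    and L: "4 * N * 4 ^ (\<Delta> * w) \<le> L * m" "w * (\<Delta> * w) * L * \<Delta> ^ (\<Delta> * w) < M"
    and wm: "w * 4 ^ (\<Delta> * w) \<le> m"
  shows "arrows_ind (bipartite_blowup G X Y N adj) H' q"
  unfolding arrows_ind_def
proof
  define G' where "G' = bipartite_blowup G X Y N adj"
  fix c assume "c \<in> edges (bipartite_blowup G X Y N adj) \<rightarrow> {..<q}"
  then have c: "c e < q" if "e \<in> edges G'" for e using that by (auto simp: G'_def)
  define pe where "pe x u = prod_encode (x, u)" for x u :: nat
  have pe_eq [simp]: "pe x u = pe x' u' \<longleftrightarrow> x = x' \<and> u = u'" for x u x' u' by (simp add: pe_def)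
  have vG': "pe g u \<in> verts G' \<longleftrightarrow> g \<in> verts G \<and> u < N" for g u
    by (auto simp: G'_def bipartite_blowup_def pe_def)
  have eG': "e \<in> edges G' \<longleftrightarrow> (\<exists>x u y r. e = {pe x u, pe y r} \<and>
      x \<in> X \<and> y \<in> Y \<and> {x, y} \<in> edges G \<and> u < N \<and> r < N \<and> adj u r)" for e
    by (auto simp: G'_def bipartite_blowup_def pe_def)
  define nb where "nb y = {x \<in> X. {x, y} \<in> edges G}" for y
  have finV: "finite (verts G)" using G(1) by (simp add: simple_graph_def)
  then have finY: "finite Y" using XY(1) by (metis finite_Un)
  have nb: "finite (nb y)" "card (nb y) \<le> \<Delta>" for y
  proof -
    note n = neighbours_le_max_degree[OF G, of y]
    have sub: "nb y \<subseteq> {x. {x, y} \<in> edges G}" by (auto simp: nb_def)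
    show "finite (nb y)" "card (nb y) \<le> \<Delta>"
      using finite_subset[OF sub n(1)] card_mono[OF n(1) sub] n(2) by auto
  qed
  have nb': "card {y \<in> Y. x \<in> nb y} \<le> \<Delta>" for x
  proof -
    note n = neighbours_le_max_degree[OF G, of x]
    have sub: "{y \<in> Y. x \<in> nb y} \<subseteq> {y. {y, x} \<in> edges G}" by (auto simp: nb_def insert_commute)
    show ?thesis using card_mono[OF n(1) sub] n(2) by simp
  qed
  define col where "col y x u r = c {pe x u, pe y r}" for y x u r
  have col: "col y x u r < q" if "y \<in> Y" "x \<in> nb y" "u < N" "r < N" "adj u r" for y x u r
    unfolding col_def using that by (intro c) (auto simp: eG' nb_def)
  obtain cc A where A: "\<And>x. A x \<subseteq> {..<N}" "\<And>x. N \<le> F ^ \<Delta> * card (A x)"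
    and cc: "\<And>y x. y \<in> Y \<Longrightarrow> x \<in> nb y \<Longrightarrow> cc y x < q"
    and common: "\<And>y S. y \<in> Y \<Longrightarrow> S \<subseteq> Sigma (nb y) A \<Longrightarrow> card S \<le> k * w \<Longrightarrow>
       m \<le> card {r \<in> {..<N}. \<forall>(x, u) \<in> S. adj u r \<and> col y x u r = cc y x}"
  proof (rule uniform_colours[where nb = nb and col = col and N = N and adj = adj and Y = Y,
        OF balanced(1) finY nb nb' pos(1,2) m col F few])
    fix A cc
    assume "\<And>x. A x \<subseteq> {..<N}" "\<And>x. N \<le> F ^ \<Delta> * card (A x)"
      "\<And>y x. y \<in> Y \<Longrightarrow> x \<in> nb y \<Longrightarrow> cc y x < q"
      "\<And>y S. y \<in> Y \<Longrightarrow> S \<subseteq> Sigma (nb y) A \<Longrightarrow> card S \<le> k * w \<Longrightarrow>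
         m \<le> card {r \<in> {..<N}. \<forall>(x, u) \<in> S. adj u r \<and> col y x u r = cc y x}"
    then show thesis by (rule that)
  qed
  \<comment> \<open>An edge \<open>e\<close> of \<open>G\<close> has exactly one end in each of \<open>X\<close> and \<open>Y\<close>.\<close>
  define cG where "cG e = cc (THE y. y \<in> e \<inter> Y) (THE x. x \<in> e \<inter> X)" for e
  have cG: "cG {x, y} = cc y x" if "x \<in> X" "y \<in> Y" for x y
  proof -
    have "(THE z. z \<in> {x, y} \<inter> X) = x" "(THE z. z \<in> {x, y} \<inter> Y) = y"
      using that XY(2) by (auto intro!: the_equality)
    then show ?thesis by (simp add: cG_def)
  qed
  have "cG \<in> edges G \<rightarrow> {..<q}"
  proof
    fix e assume e: "e \<in> edges G"
    then obtain x y where "x \<in> X" "y \<in> Y" "e = {x, y}" using XY(3) by blast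
    then show "cG e \<in> {..<q}" using e cc[of y x] cG by (auto simp: nb_def)
  qed
  then obtain K where K: "subgraph K G" "isomorphic H K" "monochromatic cG K"
    using arrows by (auto simp: arrows_def)
  obtain f where f: "bij_betw f (verts H) (verts K)" "edges K = (\<lambda>e. f ` e) ` edges H"
    using K(2) by (auto simp: isomorphic_def)
  obtain i where i: "\<And>e. e \<in> edges K \<Longrightarrow> cG e = i" using K(3) by (auto simp: monochromatic_def)
  obtain \<phi> where \<phi>: "\<And>v. v \<in> verts H' \<Longrightarrow> \<phi> v \<in> verts H"
      "\<And>u v. {u, v} \<in> edges H' \<Longrightarrow> {\<phi> u, \<phi> v} \<in> edges H"
      "\<And>z. z \<in> verts H \<Longrightarrow> card {u \<in> verts H'. \<phi> u = z} \<le> w"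
    and simple: "simple_graph H'"
    using H' unfolding blowup_def by blast
  have finH': "finite (verts H')" using simple by (simp add: simple_graph_def)
  have edgeH': "u \<in> verts H' \<and> v \<in> verts H'" if "{u, v} \<in> edges H'" for u v
    using that simple by (auto simp: simple_graph_def doubleton_eq_iff)
  define loc where "loc v = f (\<phi> v)" for v
  have loc: "loc v \<in> X \<union> Y" if "v \<in> verts H'" for v
  proof -
    have "loc v \<in> verts K" using bij_betwE[OF f(1)] \<phi>(1)[OF that] by (simp add: loc_def)
    then show ?thesis using K(1) unfolding XY(1) subgraph_def by blast
  qed
  have loc_edge: "{loc u, loc v} \<in> edges K" "{loc u, loc v} \<in> edges G" if "{u, v} \<in> edges H'" for u v
  proof -
    have "{loc u, loc v} = f ` {\<phi> u, \<phi> v}" by (simp add: loc_def)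
    then show "{loc u, loc v} \<in> edges K" unfolding f(2) using \<phi>(2)[OF that] by (rule image_eqI)
    then show "{loc u, loc v} \<in> edges G" using K(1) unfolding subgraph_def by blast
  qed
  have fibre: "card {v \<in> verts H'. loc v = g} \<le> w" for g
  proof (cases "\<exists>z \<in> verts H. f z = g")
    case True
    then obtain z where z: "z \<in> verts H" "f z = g" by blast
    have "{v \<in> verts H'. loc v = g} \<subseteq> {v \<in> verts H'. \<phi> v = z}"
      using z \<phi>(1) bij_betw_imp_inj_on[OF f(1)] by (auto simp: loc_def inj_on_def)
    then have "card {v \<in> verts H'. loc v = g} \<le> card {v \<in> verts H'. \<phi> v = z}"
      using finH' by (intro card_mono) auto
    then show ?thesis using \<phi>(3)[OF z(1)] by simp
  next
    case False
    then have "{v \<in> verts H'. loc v = g} = {}" using \<phi>(1) by (auto simp: loc_def)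
    then show ?thesis by (simp only: card.empty le0)
  qed
  define XH where "XH = {a \<in> verts H'. loc a \<in> X}"
  define Nb where "Nb y = {a \<in> XH. loc a \<in> nb y}" for y
  define V where "V y = {v \<in> verts H'. loc v = y}" for y
  define S where "S v = {a \<in> XH. {a, v} \<in> edges H'}" for v
  have finXH: "finite XH" using finH' by (simp add: XH_def)
  have S_Nb: "S v \<subseteq> Nb y" if "y \<in> Y" "v \<in> V y" for y v
    using that loc_edge(2) by (auto simp: S_def Nb_def V_def nb_def XH_def)
  \<comment> \<open>Vertices of \<open>H'\<close> above the same \<open>x\<close> choose from disjoint pieces of \<open>A x\<close>, so they get distinct
    images whatever they choose.\<close>
  define pieces where "pieces x p \<longleftrightarrow>
      (\<forall>a \<in> {a \<in> XH. loc a = x}. p a \<subseteq> A x \<and> card (p a) = M) \<and>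
      (\<forall>a \<in> {a \<in> XH. loc a = x}. \<forall>b \<in> {a \<in> XH. loc a = x}. a \<noteq> b \<longrightarrow> p a \<inter> p b = {})"
    for x and p :: "'c \<Rightarrow> nat set"
  have "\<exists>p. pieces x p" for x
    unfolding pieces_def
  proof (rule disjoint_pieces)
    have "card {a \<in> XH. loc a = x} \<le> card {v \<in> verts H'. loc v = x}"
      using finH' by (intro card_mono) (auto simp: XH_def)
    also note fibre[of x]
    finally have "M * card {a \<in> XH. loc a = x} \<le> w * M"
      unfolding mult.commute[of w] by (rule mult_le_mono2)
    moreover have "F ^ \<Delta> * (w * M) \<le> F ^ \<Delta> * card (A x)"
      using le_trans[OF M A(2)[of x]] by (simp only: mult.commute)
    then have "w * M \<le> card (A x)" using pos(2) by (simp add: F(1))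
    ultimately show "M * card {a \<in> XH. loc a = x} \<le> card (A x)" by (rule le_trans)
  qed (use finXH in simp)
  then obtain P where "\<And>x. pieces x (P x)" by metis
  then have P: "\<And>x a. a \<in> XH \<Longrightarrow> loc a = x \<Longrightarrow> P x a \<subseteq> A x \<and> card (P x a) = M"
    "\<And>x a b. a \<in> XH \<Longrightarrow> loc a = x \<Longrightarrow> b \<in> XH \<Longrightarrow> loc b = x \<Longrightarrow> a \<noteq> b \<Longrightarrow> P x a \<inter> P x b = {}"
    unfolding pieces_def by blast+
  define \<Omega> where "\<Omega> a = P (loc a) a" for a
  have \<Omega>: "\<Omega> a \<subseteq> A (loc a)" "card (\<Omega> a) = M" if "a \<in> XH" for a using P(1)[OF that] by (auto simp: \<Omega>_def)
  define g where "g y a u r \<longleftrightarrow> adj u r \<and> col y (loc a) u r = i" for y a u r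
  have cardS: "card (S v) \<le> k * w" if "v \<in> verts H'" for v
  proof -
    note n = neighbours_le_max_degree[OF H, of "\<phi> v"]
    have "card (S v) \<le> card {z. {z, \<phi> v} \<in> edges H} * w"
    proof (rule card_le_of_cover[OF n(1)])
      show "S v \<subseteq> (\<Union>z \<in> {z. {z, \<phi> v} \<in> edges H}. {a \<in> verts H'. \<phi> a = z})"
        using \<phi>(2) by (auto simp: S_def XH_def)
      show "card {a \<in> verts H'. \<phi> a = z} \<le> w" if "z \<in> {z. {z, \<phi> v} \<in> edges H}" for z
        using that H(1) by (intro \<phi>(3)) (auto simp: simple_graph_def doubleton_eq_iff)
    qed (use finH' in simp)
    then show ?thesis using n(2) by (meson le_trans mult_le_mono1)
  qed
  have "\<exists>\<omega> \<in> PiE XH \<Omega>. \<forall>y \<in> Y. \<forall>v \<in> V y. m \<le> 4 ^ (\<Delta> * w) *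
       card {r \<in> {..<N}. (\<forall>a \<in> S v. g y a (\<omega> a) r) \<and> (\<forall>a \<in> Nb y - S v. \<not> adj (\<omega> a) r)}"
  proof (rule choose_spread_vertices[where Nb = Nb and S = S and V = V and g = g and d = \<Delta> and Y = Y
        and K = "\<Delta> * w" and G = L and M = M and w = w and m = m, OF balanced(2) finXH])
    show "\<Omega> a \<subseteq> {..<N}" "card (\<Omega> a) = M" if "a \<in> XH" for a using \<Omega>[OF that] A(1) by auto
    show "Nb y \<subseteq> XH" for y by (auto simp: Nb_def)
    show "card (Nb y) \<le> \<Delta> * w" for y
    proof -
      have "card (Nb y) \<le> card (nb y) * w"
        by (rule card_le_of_cover[OF nb(1) _ fibre]) (use finH' in \<open>auto simp: Nb_def XH_def\<close>)
      then show ?thesis using nb(2)[of y] by (meson le_trans mult_le_mono1)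
    qed
    show "card {y \<in> Y. a \<in> Nb y} \<le> \<Delta>" if "a \<in> XH" for a
      using nb'[of "loc a"] that by (simp add: Nb_def)
    show "finite (V y)" "card (V y) \<le> w" for y using finH' fibre by (auto simp: V_def)
    show "S v \<subseteq> Nb y" if "y \<in> Y" "v \<in> V y" for y v by (rule S_Nb[OF that])
    show "m \<le> card {r \<in> {..<N}. \<forall>a \<in> S v. g y a (\<omega> a) r}"
      if \<omega>: "\<omega> \<in> PiE XH \<Omega>" and y: "y \<in> Y" and v: "v \<in> V y" for \<omega> y v
    proof -
      let ?T = "(\<lambda>a. (loc a, \<omega> a)) ` S v"
      have finS: "finite (S v)" using finXH by (simp add: S_def)
      have "m \<le> card {r \<in> {..<N}. \<forall>(x, u) \<in> ?T. adj u r \<and> col y x u r = cc y x}"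
      proof (rule common[OF y])
        show "?T \<subseteq> Sigma (nb y) A"
          using S_Nb[OF y v] \<omega> \<Omega>(1) by (fastforce simp: Nb_def)
        show "card ?T \<le> k * w"
          using card_image_le[OF finS, of "\<lambda>a. (loc a, \<omega> a)"] cardS[of v] v by (simp add: V_def)
      qed
      also have "{r \<in> {..<N}. \<forall>(x, u) \<in> ?T. adj u r \<and> col y x u r = cc y x}
          = {r \<in> {..<N}. \<forall>a \<in> S v. g y a (\<omega> a) r}"
      proof -
        have "cc y (loc a) = i" if "a \<in> S v" for a
          using that i[OF loc_edge(1)[of a v]] cG[of "loc a" y] y v by (auto simp: S_def XH_def V_def)
        then show ?thesis by (auto simp: g_def)
      qed
      finally show ?thesis .
    qed
  next
    fix \<omega> assume "\<omega> \<in> PiE XH \<Omega>" "\<And>y v. y \<in> Y \<Longrightarrow> v \<in> V y \<Longrightarrow> m \<le> 4 ^ (\<Delta> * w) *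
       card {r \<in> {..<N}. (\<forall>a \<in> S v. g y a (\<omega> a) r) \<and> (\<forall>a \<in> Nb y - S v. \<not> adj (\<omega> a) r)}"
    then show ?thesis by (intro bexI[of _ \<omega>]) auto
  qed (use finY pos L in auto)
  then obtain \<omega> where \<omega>: "\<omega> \<in> PiE XH \<Omega>"
    and spread: "\<And>y v. y \<in> Y \<Longrightarrow> v \<in> V y \<Longrightarrow> m \<le> 4 ^ (\<Delta> * w) *
       card {r \<in> {..<N}. (\<forall>a \<in> S v. g y a (\<omega> a) r) \<and> (\<forall>a \<in> Nb y - S v. \<not> adj (\<omega> a) r)}"
    by blast
  define R where "R y v =
      {r \<in> {..<N}. (\<forall>a \<in> S v. g y a (\<omega> a) r) \<and> (\<forall>a \<in> Nb y - S v. \<not> adj (\<omega> a) r)}" for y v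
  have "\<exists>\<rho>. inj_on \<rho> (V y) \<and> (\<forall>v \<in> V y. \<rho> v \<in> R y v)" if y: "y \<in> Y" for y
  proof (rule distinct_representatives)
    fix v assume v: "v \<in> V y"
    have "4 ^ (\<Delta> * w) * w \<le> 4 ^ (\<Delta> * w) * card (R y v)"
      using le_trans[OF wm spread[OF y v]] unfolding R_def by (simp only: mult.commute)
    then have "w \<le> card (R y v)" by simp
    then show "card (V y) \<le> card (R y v)" using fibre[of y] by (simp add: V_def)
  qed (use finH' in \<open>auto simp: V_def R_def\<close>)
  then obtain \<rho> where \<rho>: "\<And>y. y \<in> Y \<Longrightarrow> inj_on (\<rho> y) (V y)" "\<And>y v. y \<in> Y \<Longrightarrow> v \<in> V y \<Longrightarrow> \<rho> y v \<in> R y v"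
    by metis
  define h where "h v = (if loc v \<in> X then pe (loc v) (\<omega> v) else pe (loc v) (\<rho> (loc v) v))" for v
  have \<rho>R: "\<rho> (loc v) v \<in> R (loc v) v" if "v \<in> verts H'" "loc v \<in> Y" for v
    using \<rho>(2)[of "loc v" v] that by (simp add: V_def)
  have inj: "inj_on h (verts H')"
  proof (rule inj_onI)
    fix u v assume uv: "u \<in> verts H'" "v \<in> verts H'" "h u = h v"
    then have eq: "loc u = loc v" by (auto simp: h_def split: if_splits)
    show "u = v"
    proof (cases "loc u \<in> X")
      case True
      then have "u \<in> XH" "v \<in> XH" "\<omega> u = \<omega> v" using uv eq by (auto simp: XH_def h_def)
      moreover from this have "\<omega> u \<in> \<Omega> u" "\<omega> v \<in> \<Omega> v" by (blast intro: PiE_mem[OF \<omega>])+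
      ultimately show ?thesis using P(2)[of u "loc v" v] eq by (auto simp: \<Omega>_def)
    next
      case False
      then have "\<rho> (loc v) u = \<rho> (loc v) v" "loc v \<in> Y" using uv eq loc by (auto simp: h_def)
      then show ?thesis using \<rho>(1)[of "loc v"] uv eq by (auto simp: V_def inj_on_def)
    qed
  qed
  have orient: "\<exists>a v. e = {a, v} \<and> {a, v} \<in> edges H' \<and> loc a \<in> X \<and> loc v \<in> Y" if e: "e \<in> edges H'" for e
  proof -
    obtain u v where uv: "e = {u, v}" using e simple unfolding simple_graph_def by blast
    then have "{loc u, loc v} \<in> edges G" using loc_edge(2) e by simp
    then obtain x y where "x \<in> X" "y \<in> Y" "{loc u, loc v} = {x, y}" using XY(3) by blast
    then have "loc u \<in> X \<and> loc v \<in> Y \<or> loc v \<in> X \<and> loc u \<in> Y" by (auto simp: doubleton_eq_iff)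
    then show ?thesis using uv e insert_commute[of u v "{}"] by metis
  qed
  have hX: "h a = pe (loc a) (\<omega> a)" if "loc a \<in> X" for a using that by (simp add: h_def)
  have hY: "h v = pe (loc v) (\<rho> (loc v) v)" if "loc v \<in> Y" for v using that XY(2) by (auto simp: h_def)
  have \<omega>N: "\<omega> a < N" if "a \<in> XH" for a using \<omega> \<Omega>(1)[OF that] A(1) that by fastforce
  have image_edge: "h ` e \<in> edges G' \<and> c (h ` e) = i" if e: "e \<in> edges H'" for e
  proof -
    obtain a v where av: "e = {a, v}" "{a, v} \<in> edges H'" "loc a \<in> X" "loc v \<in> Y" using orient[OF e] by blast
    then have "v \<in> verts H'" "a \<in> S v" "a \<in> XH" using edgeH'[of a v] by (auto simp: S_def XH_def)
    then have "g (loc v) a (\<omega> a) (\<rho> (loc v) v)" "\<rho> (loc v) v < N" "\<omega> a < N"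
      using \<rho>R[of v] av \<omega>N by (auto simp: R_def)
    moreover have "h ` e = {pe (loc a) (\<omega> a), pe (loc v) (\<rho> (loc v) v)}" using av hX hY by simp
    ultimately show ?thesis using av loc_edge(2)[of a v] by (auto simp: eG' g_def col_def)
  qed
  define K' where "K' = Graph (h ` verts H') ((\<lambda>e. h ` e) ` edges H')"
  have "induced_subgraph K' G'"
    unfolding induced_subgraph_def
  proof
    show "verts K' \<subseteq> verts G'"
    proof
      fix p assume "p \<in> verts K'"
      then obtain v where v: "v \<in> verts H'" "p = h v" by (auto simp: K'_def)
      show "p \<in> verts G'"
      proof (cases "loc v \<in> X")
        case True
        then show ?thesis using v \<omega>N[of v] XY(1) by (auto simp: hX vG' XH_def)
      next
        case False
        then have "loc v \<in> Y" using loc v by auto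
        then show ?thesis using v \<rho>R[of v] XY(1) by (auto simp: hY vG' R_def)
      qed
    qed
    show "edges K' = {e \<in> edges G'. e \<subseteq> verts K'}"
    proof (intro equalityI subsetI)
      fix e assume "e \<in> edges K'"
      then obtain e0 where e0: "e0 \<in> edges H'" "e = h ` e0" by (auto simp: K'_def)
      moreover have "e0 \<subseteq> verts H'" using e0(1) simple by (auto simp: simple_graph_def)
      ultimately show "e \<in> {e \<in> edges G'. e \<subseteq> verts K'}" using image_edge by (auto simp: K'_def)
    next
      fix e assume "e \<in> {e \<in> edges G'. e \<subseteq> verts K'}"
      then obtain x u y r where e: "e = {pe x u, pe y r}" "x \<in> X" "y \<in> Y" "{x, y} \<in> edges G" "adj u r"
        and sub: "pe x u \<in> h ` verts H'" "pe y r \<in> h ` verts H'"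
        by (auto simp: eG' K'_def)
      obtain a v where a: "a \<in> verts H'" "pe x u = h a" and v: "v \<in> verts H'" "pe y r = h v"
        using sub by blast
      have a': "loc a = x" "u = \<omega> a" using a e(2) by (auto simp: h_def split: if_splits)
      have v': "loc v = y" "r = \<rho> y v" using v e(3) XY(2) by (auto simp: h_def split: if_splits)
      have "a \<in> Nb y" using a a' e by (auto simp: Nb_def XH_def nb_def)
      moreover have "\<rho> y v \<in> R y v" using \<rho>R[of v] v v' e(3) by simp
      ultimately have "a \<in> S v" using e(5) a' v' by (auto simp: R_def)
      then have "{a, v} \<in> edges H'" by (simp add: S_def)
      moreover have "e = h ` {a, v}" using e(1) a v by simp
      ultimately show "e \<in> edges K'" unfolding K'_def graph.sel by blast
    qed
  qed
  moreover have "isomorphic H' K'"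
    unfolding isomorphic_def K'_def using inj by (intro exI[of _ h]) (simp add: bij_betw_def)
  moreover have "monochromatic c K'"
    unfolding monochromatic_def K'_def using image_edge by auto
  ultimately show "\<exists>K. induced_subgraph K (bipartite_blowup G X Y N adj) \<and> isomorphic H' K \<and> monochromatic c K"
    unfolding G'_def by blast
qed

section \<open>Choice of parameters\<close>

text \<open>
  All bounds become inequalities between exponents of \<open>D\<close>. The sets \<open>A x\<close> lose a factor of at most
  \<open>F ^ \<Delta> \<le> D ^ (8 * e)\<close>, which makes \<open>e\<close> the right scale. Dependent random choice with samples of size
  \<open>2 * (k * w)\<close> needs \<open>m\<close> to stay somewhat below \<open>sqrt N\<close>, whereas the unbalanced vertices, about
  \<open>N / m\<close> of them, must be far fewer than the vertices in \<open>A x\<close>, which needs \<open>m\<close> well above \<open>D ^ (8 * e)\<close>.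
  The exponents 50 for \<open>N\<close> and 18 for \<open>m\<close> leave room for both.
\<close>

lemma blowup_parameters:
  fixes D \<Delta> q k w :: nat
  assumes D: "2 \<le> D" "\<Delta> \<le> D" "q \<le> D" and pos: "1 \<le> \<Delta>" "1 \<le> q" "1 \<le> k" "1 \<le> w"
  defines "e \<equiv> k * \<Delta>\<^sup>2 * w" and "F \<equiv> 2 * (4 * q) ^ (\<Delta> * (2 * (k * w)))"
  shows "8 * \<Delta> * F ^ \<Delta> \<le> D ^ (50 * e)"
    "(\<Delta> * D ^ (50 * e)) ^ (k * w) * (D ^ (18 * e)) ^ (2 * (k * w)) * F * (2 * q ^ \<Delta>) ^ (2 * (k * w))
      < (D ^ (50 * e)) ^ (2 * (k * w))"
    "w * D ^ (41 * e) * F ^ \<Delta> \<le> D ^ (50 * e)"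
    "4 * D ^ (50 * e) * 4 ^ (\<Delta> * w) \<le> D ^ (36 * e) * D ^ (18 * e)"
    "w * (\<Delta> * w) * D ^ (36 * e) * \<Delta> ^ (\<Delta> * w) < D ^ (41 * e)"
    "w * 4 ^ (\<Delta> * w) \<le> D ^ (18 * e)"
proof -
  define l where "l = k * w"
  have l: "1 \<le> l" using pos by (simp add: l_def)
  have e_eq: "e = \<Delta> * (\<Delta> * l)" by (simp add: e_def l_def power2_eq_square algebra_simps)
  have wl: "w \<le> l" using pos by (simp add: l_def)
  have dle: "\<Delta> \<le> \<Delta> * l" "l \<le> \<Delta> * l" "\<Delta> * w \<le> \<Delta> * l" using pos l wl by auto
  have ele: "\<Delta> * l \<le> e" unfolding e_eq using pos by simp
  have De: "\<Delta> \<le> e" "w \<le> e" "\<Delta> * w \<le> e" "1 \<le> e" using dle ele wl pos by linarith+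
  have up: "D ^ a \<le> D ^ b" if "a \<le> b" for a b using that D(1) by (intro power_increasing) auto
  have up_less: "D ^ a < D ^ b" if "a < b" for a b using that D(1) by (intro power_strict_increasing) auto
  have four: "4 \<le> D ^ 2" using power_mono[OF D(1), of 2] by simp
  have eight: "8 \<le> D ^ 3" using power_mono[OF D(1), of 3] by simp
  have w: "w \<le> D ^ w"
    using power_mono[OF D(1), of w] less_exp[of w] by linarith
  have four_pow: "4 ^ (\<Delta> * w) \<le> D ^ (2 * (\<Delta> * w))"
    using power_mono[OF four, of "\<Delta> * w"] by (simp add: power_mult)
  have F: "F \<le> D ^ (8 * (\<Delta> * l))"
  proof -
    have "4 * q \<le> D ^ 2 * D" using four D(3) by (rule mult_mono) auto
    then have "4 * q \<le> D ^ 3" by (simp add: power2_eq_square power3_eq_cube)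
    then have "(4 * q) ^ (\<Delta> * (2 * l)) \<le> (D ^ 3) ^ (\<Delta> * (2 * l))" by (rule power_mono) simp
    then have "F \<le> D * (D ^ 3) ^ (\<Delta> * (2 * l))"
      unfolding F_def l_def using D(1) by (intro mult_mono) auto
    also have "\<dots> = D ^ (1 + 3 * (\<Delta> * (2 * l)))"
      by (simp only: power_add power_one_right power_mult[of D 3])
    also have "\<dots> \<le> D ^ (8 * (\<Delta> * l))" using dle pos by (intro up) linarith
    finally show ?thesis .
  qed
  have FD: "F ^ \<Delta> \<le> D ^ (8 * e)"
  proof -
    have "F ^ \<Delta> \<le> (D ^ (8 * (\<Delta> * l))) ^ \<Delta>" using F by (rule power_mono) simp
    also have "\<dots> = D ^ (8 * e)" by (simp add: e_eq power_mult[symmetric] algebra_simps)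
    finally show ?thesis .
  qed
  have "8 * \<Delta> * F ^ \<Delta> \<le> D ^ 3 * D * D ^ (8 * e)" using eight D(2) FD by (intro mult_mono) auto
  also have "\<dots> = D ^ (4 + 8 * e)" by (simp add: power_add numeral_eq_Suc)
  also have "\<dots> \<le> D ^ (50 * e)" using De by (intro up) linarith
  finally show "8 * \<Delta> * F ^ \<Delta> \<le> D ^ (50 * e)" .
  have "(\<Delta> * D ^ (50 * e)) ^ l * (D ^ (18 * e)) ^ (2 * l) * F * (2 * q ^ \<Delta>) ^ (2 * l)
      \<le> (D * D ^ (50 * e)) ^ l * (D ^ (18 * e)) ^ (2 * l) * D ^ (8 * (\<Delta> * l)) * (D * D ^ \<Delta>) ^ (2 * l)"
    using D F by (intro mult_mono power_mono) auto
  also have "\<dots> = (D ^ (1 + 50 * e)) ^ l * (D ^ (18 * e)) ^ (2 * l) * D ^ (8 * (\<Delta> * l)) * (D ^ (1 + \<Delta>)) ^ (2 * l)"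
    by simp
  also have "\<dots> = D ^ ((1 + 50 * e) * l + 18 * e * (2 * l) + 8 * (\<Delta> * l) + (1 + \<Delta>) * (2 * l))"
    by (simp only: power_mult[symmetric] power_add[symmetric])
  also have "\<dots> < D ^ (50 * e * (2 * l))"
  proof (rule up_less)
    have "\<Delta> * l \<le> e * l" "1 * l \<le> e * l" "0 < l" using De l by auto
    moreover have "1 * l \<le> \<Delta> * l" using pos by auto
    ultimately have "3 * l + 10 * (\<Delta> * l) < 14 * (e * l)" by linarith
    then show "(1 + 50 * e) * l + 18 * e * (2 * l) + 8 * (\<Delta> * l) + (1 + \<Delta>) * (2 * l) < 50 * e * (2 * l)"
      by (simp add: algebra_simps)
  qed
  also have "\<dots> = (D ^ (50 * e)) ^ (2 * l)" by (simp only: power_mult)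
  finally show "(\<Delta> * D ^ (50 * e)) ^ (k * w) * (D ^ (18 * e)) ^ (2 * (k * w)) * F * (2 * q ^ \<Delta>) ^ (2 * (k * w))
      < (D ^ (50 * e)) ^ (2 * (k * w))" unfolding l_def .
  have "w * D ^ (41 * e) * F ^ \<Delta> \<le> D ^ w * D ^ (41 * e) * D ^ (8 * e)"
    using w FD by (intro mult_mono) auto
  also have "\<dots> = D ^ (w + 41 * e + 8 * e)" by (simp only: power_add)
  also have "\<dots> \<le> D ^ (50 * e)" using De by (intro up) linarith
  finally show "w * D ^ (41 * e) * F ^ \<Delta> \<le> D ^ (50 * e)" .
  have "4 * D ^ (50 * e) * 4 ^ (\<Delta> * w) \<le> D ^ 2 * D ^ (50 * e) * D ^ (2 * (\<Delta> * w))"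
    using four four_pow by (intro mult_mono) auto
  also have "\<dots> = D ^ (2 + 50 * e + 2 * (\<Delta> * w))" by (simp only: power_add)
  also have "\<dots> \<le> D ^ (36 * e + 18 * e)" using De by (intro up) linarith
  finally show "4 * D ^ (50 * e) * 4 ^ (\<Delta> * w) \<le> D ^ (36 * e) * D ^ (18 * e)" by (simp only: power_add)
  have "w * (\<Delta> * w) * D ^ (36 * e) * \<Delta> ^ (\<Delta> * w)
      \<le> D ^ w * (D ^ 1 * D ^ w) * D ^ (36 * e) * D ^ (\<Delta> * w)"
    using w D by (intro mult_mono power_mono) auto
  also have "\<dots> = D ^ (w + (1 + w) + 36 * e + \<Delta> * w)" by (simp only: power_add)
  also have "\<dots> < D ^ (41 * e)" using De by (intro up_less) linarith
  finally show "w * (\<Delta> * w) * D ^ (36 * e) * \<Delta> ^ (\<Delta> * w) < D ^ (41 * e)" .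
  have "w * 4 ^ (\<Delta> * w) \<le> D ^ w * D ^ (2 * (\<Delta> * w))" using w four_pow by (intro mult_mono) auto
  also have "\<dots> = D ^ (w + 2 * (\<Delta> * w))" by (simp only: power_add)
  also have "\<dots> \<le> D ^ (18 * e)" using De by (intro up) linarith
  finally show "w * 4 ^ (\<Delta> * w) \<le> D ^ (18 * e)" .
qed

lemma ex_power_of_two_between:
  assumes "2 \<le> (x :: nat)"
  shows "\<exists>L. x \<le> 2 ^ L \<and> 2 ^ L \<le> x\<^sup>2"
proof -
  obtain L where L: "2 ^ L \<le> x" "x < 2 ^ (L + 1)"
    using ex_power_ivl1[of 2 x] assms by auto
  have "2 ^ (L + 1) \<le> 2 * x" using L(1) by simp
  also have "\<dots> \<le> x\<^sup>2" using assms by (simp add: power2_eq_square)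
  finally show ?thesis using L(2) by (intro exI[of _ "L + 1"]) simp
qed

text \<open>
  \<open>N\<close> must be a power of two to be the order of a Sylvester matrix. Rounding \<open>\<Delta> * q\<close> up to a power
  of two costs at most squaring it, which doubles the exponent 50. If \<open>H'\<close> has no vertices, then \<open>w\<close>
  may be zero, and the empty graph does.
\<close>

lemma ex_blowup_arrows_ind:
  fixes H G H' :: "nat graph"
  assumes H: "simple_graph H" "max_degree H \<le> k" and G: "simple_graph G" "bipartite G" "max_degree G \<le> \<Delta>"
    and arrows: "arrows G H q" and H': "blowup w H' H" and k: "1 \<le> k" and \<Delta>q: "2 \<le> \<Delta> * q"
  defines "s \<equiv> (\<Delta> * q) ^ (100 * k * \<Delta>\<^sup>2 * w)"
  shows "\<exists>G' :: nat graph. blowup s G' G \<and> arrows_ind G' H' q \<and>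
     card (verts G') \<le> s * card (verts G) \<and> card (edges G') \<le> s\<^sup>2 * card (edges G)"
proof (cases "verts H' = {}")
  case True
  have "simple_graph H'" using H' by (simp add: blowup_def)
  then have "edges H' = {}" using True by (auto simp: simple_graph_def)
  then have "isomorphic H' (Graph {} {} :: nat graph)"
    using True by (simp add: isomorphic_def bij_betw_def)
  moreover have "induced_subgraph (Graph {} {}) (Graph {} {} :: nat graph)"
    "monochromatic c (Graph {} {} :: nat graph)" for c
    by (simp_all add: induced_subgraph_def monochromatic_def)
  ultimately have "arrows_ind (Graph {} {} :: nat graph) H' q"
    unfolding arrows_ind_def by blast
  moreover have "blowup s (Graph {} {} :: nat graph) G" by (auto simp: blowup_def simple_graph_def)
  ultimately show ?thesis by (intro exI[of _ "Graph {} {}"]) simp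
next
  case False
  then obtain v where v: "v \<in> verts H'" by blast
  obtain \<phi> where "\<phi> \<in> verts H' \<rightarrow> verts H" "\<forall>z \<in> verts H. card {u \<in> verts H'. \<phi> u = z} \<le> w"
    and fin: "finite (verts H')"
    using H' unfolding blowup_def simple_graph_def by blast
  then have le: "card {u \<in> verts H'. \<phi> u = \<phi> v} \<le> w" using v by blast
  have "v \<in> {u \<in> verts H'. \<phi> u = \<phi> v}" using v by simp
  then have "card {u \<in> verts H'. \<phi> u = \<phi> v} \<noteq> 0" using fin by auto
  then have w: "1 \<le> w" using le by linarith
  have \<Delta>: "1 \<le> \<Delta>" and q: "1 \<le> q" using \<Delta>q by (auto simp: Suc_le_eq intro!: Nat.gr0I)
  obtain X Y where XY: "X \<union> Y = verts G" "X \<inter> Y = {}"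
    "\<And>e. e \<in> edges G \<Longrightarrow> \<exists>x \<in> X. \<exists>y \<in> Y. e = {x, y}"
    using G(2) by (auto simp: bipartite_def)
  obtain L where L: "\<Delta> * q \<le> 2 ^ L" "2 ^ L \<le> (\<Delta> * q)\<^sup>2" using ex_power_of_two_between[OF \<Delta>q] by blast
  define D :: nat where "D = 2 ^ L"
  define e where "e = k * \<Delta>\<^sup>2 * w"
  define N where "N = D ^ (50 * e)"
  have "\<Delta> * 1 \<le> \<Delta> * q" "1 * q \<le> \<Delta> * q" using \<Delta> q by (intro mult_le_mono; simp)+
  then have D: "2 \<le> D" "\<Delta> \<le> D" "q \<le> D" using L(1) \<Delta>q unfolding D_def by linarith+
  note par = blowup_parameters[OF D \<Delta> q k w, folded e_def, folded N_def]
  have N: "N = 2 ^ (L * (50 * e))" by (simp add: N_def D_def power_mult)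
  have "N \<le> ((\<Delta> * q)\<^sup>2) ^ (50 * e)" unfolding N_def D_def using L(2) by (rule power_mono) simp
  also have "\<dots> = s" by (simp add: s_def e_def power_mult[symmetric] algebra_simps)
  finally have Ns: "N \<le> s" .
  obtain adj where adj: "\<And>A. A \<subseteq> {..<N} \<Longrightarrow>
      card {r \<in> {..<N}. 4 * card {u \<in> A. adj u r} < card A} * card A \<le> 4 * N"
    "\<And>Z. Z \<subseteq> {..<N} \<Longrightarrow>
      card {u \<in> {..<N}. 4 * card {r \<in> Z. \<not> adj u r} < card Z} * card Z \<le> 4 * N"
    using ex_balanced_bipartite_graph[of "L * (50 * e)"] unfolding N by blast
  define G' where "G' = bipartite_blowup G X Y N adj"
  note G' = bipartite_blowup[OF G(1) XY(1,2), of N adj, folded G'_def]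
  have mN: "D ^ (18 * e) \<le> N" unfolding N_def using D(1) by (intro power_increasing) auto
  have pos: "0 < \<Delta>" "0 < q" "0 < D ^ (18 * e)" using \<Delta> q D(1) by auto
  have "arrows_ind G' H' q"
    unfolding G'_def
    by (rule bipartite_blowup_arrows_ind[where N = N and adj = adj and m = "D ^ (18 * e)"
          and t = "2 * (k * w)" and M = "D ^ (41 * e)" and L = "D ^ (36 * e)"
          and F = "2 * (4 * q) ^ (\<Delta> * (2 * (k * w)))" and \<Delta> = \<Delta> and k = k and w = w and q = q,
          OF adj H G(1,3) XY arrows H' pos mN refl par])
  moreover have "blowup s G' G"
    by (rule blowup_mono[OF G'(1) Ns])
  moreover have "card (verts G') \<le> s * card (verts G)" using G'(2) Ns by simp
  moreover have "card (edges G') \<le> s\<^sup>2 * card (edges G)"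
    by (rule le_trans[OF G'(3) mult_le_mono1[OF power_mono[OF Ns le0]]])
  ultimately show ?thesis by blast
qed

theorem theorem5:
  "\<exists>C :: nat. \<forall>(H :: nat graph) (G :: nat graph) (H' :: nat graph) (q :: nat) (k :: nat) (\<Delta> :: nat) (w :: nat).
     simple_graph H \<and> simple_graph G \<and> bipartite H \<and> bipartite G \<and> arrows G H q \<and>
     max_degree H \<le> k \<and> max_degree G \<le> \<Delta> \<and> blowup w H' H \<and>
     1 \<le> k \<and> 2 \<le> \<Delta> * q \<longrightarrow>
     (let s = (\<Delta> * q) ^ (C * k * \<Delta>\<^sup>2 * w) in
        (\<exists>G' :: nat graph. blowup s G' G \<and> arrows_ind G' H' q) \<and>
        r_ind H' q \<le> enat (s * card (verts G)) \<and>
        size_r_ind H' q \<le> enat (s\<^sup>2 * card (edges G)) \<and>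
        s\<^sup>2 * card (edges G) \<le> s\<^sup>2 * \<Delta> * card (verts G))"
proof (intro exI[of _ 100] allI impI)
  fix H G H' :: "nat graph" and q k \<Delta> w :: nat
  assume "simple_graph H \<and> simple_graph G \<and> bipartite H \<and> bipartite G \<and> arrows G H q \<and>
     max_degree H \<le> k \<and> max_degree G \<le> \<Delta> \<and> blowup w H' H \<and> 1 \<le> k \<and> 2 \<le> \<Delta> * q"
  then have H: "simple_graph H" "max_degree H \<le> k"
    and G: "simple_graph G" "bipartite G" "max_degree G \<le> \<Delta>"
    and arrows: "arrows G H q" and H': "blowup w H' H" and pos: "1 \<le> k" "2 \<le> \<Delta> * q"
    by auto
  define s where "s = (\<Delta> * q) ^ (100 * k * \<Delta>\<^sup>2 * w)"
  obtain G' :: "nat graph" where G': "blowup s G' G" "arrows_ind G' H' q"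
    "card (verts G') \<le> s * card (verts G)" "card (edges G') \<le> s\<^sup>2 * card (edges G)"
    using ex_blowup_arrows_ind[OF H G arrows H' pos, folded s_def] by blast
  have simple: "simple_graph G'" using G'(1) by (simp add: blowup_def)
  have "r_ind H' q \<le> enat (card (verts G'))"
    unfolding r_ind_def using simple G'(2) by (intro Inf_lower) blast
  also have "\<dots> \<le> enat (s * card (verts G))" using G'(3) by simp
  finally have r: "r_ind H' q \<le> enat (s * card (verts G))" .
  have "size_r_ind H' q \<le> enat (card (edges G'))"
    unfolding size_r_ind_def using simple G'(2) by (intro Inf_lower) blast
  also have "\<dots> \<le> enat (s\<^sup>2 * card (edges G))" using G'(4) by simp
  finally have size: "size_r_ind H' q \<le> enat (s\<^sup>2 * card (edges G))" .
  have "card (edges G) \<le> \<Delta> * card (verts G)" using card_edges_le_max_degree[OF G(1,3)] .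
  then have "s\<^sup>2 * card (edges G) \<le> s\<^sup>2 * \<Delta> * card (verts G)"
    unfolding mult.assoc by (rule mult_le_mono2)
  then show "let s = (\<Delta> * q) ^ (100 * k * \<Delta>\<^sup>2 * w) in
        (\<exists>G' :: nat graph. blowup s G' G \<and> arrows_ind G' H' q) \<and>
        r_ind H' q \<le> enat (s * card (verts G)) \<and>
        size_r_ind H' q \<le> enat (s\<^sup>2 * card (edges G)) \<and>
        s\<^sup>2 * card (edges G) \<le> s\<^sup>2 * \<Delta> * card (verts G)"
    unfolding Let_def s_def[symmetric] using G'(1,2) r size by blast
qed

end
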